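(* Let $a<b$, let $n_0,n_1,n_2\ge 0$ be integers, and let $B\in\mathbb{R}^{(n_1+2n_2)\times(2n_1+4n_2)}$ be such that $BT$ is invertible, with $T$, the space $X$ (equipped with $\langle\cdot,\cdot\rangle_X$), and the functions $G_0,G_1,G_2$ as defined in the context. Then the operator $\mathcal{T}=\mathcal{P}_{\{G_0,G_1,G_2\}}:L_2^{n_0+n_1+n_2}\to X$ is unitary, i.e. it is a surjective linear map and $\langle\mathcal{T}\hat{\mathbf{x}},\mathcal{T}\hat{\mathbf{y}}\rangle_X=\langle\hat{\mathbf{x}},\hat{\mathbf{y}}\rangle_{L_2}$ for all $\hat{\mathbf{x}},\hat{\mathbf{y}}\in L_2^{n_0+n_1+n_2}$.
   Context: $L_2^m=L_2([a,b];\mathbb{R}^m)$ with its standard inner product; $H_k^m$ is the Sobolev space of $\mathbb{R}^m$-valued functions on $[a,b]$ whose weak derivatives up to order $k$ are in $L_2$. A subscript $s$ denotes $\partial_s$. 3-PI operators: for bounded measurable matrix-valued functions $N_0$ on $[a,b]$ and $N_1,N_2$ on $[a,b]^2$, $$(\mathcal{P}_{\{N_0,N_1,N_2\}}\mathbf{x})(s)=N_0(s)\mathbf{x}(s)+\int_a^s N_1(s,\theta)\mathbf{x}(\theta)\,d\theta+\int_s^b N_2(s,\theta)\mathbf{x}(\theta)\,d\theta .$$ The matrix $T\in\mathbb{R}^{(2n_1+4n_2)\times(n_1+2n_2)}$ is $$T=\begin{bmatrix} I_{n_1}&0&0\\ I_{n_1}&0&0\\ 0&I_{n_2}&0\\ 0&I_{n_2}&(b-a)I_{n_2}\\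 0&0&I_{n_2}\\ 0&0&I_{n_2}\end{bmatrix}.$$ The space $X$ is the set of $\mathbf{x}=(x_0,x_1,x_2)\in L_2^{n_0}\times H_1^{n_1}\times H_2^{n_2}$ such that $$B\begin{bmatrix} x_1(a)\\ x_1(b)\\ x_2(a)\\ x_2(b)\\ x_{2s}(a)\\ x_{2s}(b)\end{bmatrix}=0,$$ and $\langle\mathbf{x},\mathbf{y}\rangle_X=\langle x_0,y_0\rangle_{L_2}+\langle\partial_s x_1,\partial_s y_1\rangle_{L_2}+\langle\partial_s^2x_2,\partial_s^2y_2\rangle_{L_2}$. Define (columns of $Q$ and rows of $K$ partitioned as $n_0,n_1,n_2$; columns of $K$ partitioned as $n_1,n_2,n_2$) $$Q(s,\theta)=\begin{bmatrix} 0&0&0\\ 0&I_{n_1}&0\\ 0&0&0\\ 0&0&(b-\theta)I_{n_2}\\ 0&0&0\\ 0&0&I_{n_2}\end{bmatrix},\quad K(s)=\begin{bmatrix} 0&0&0\\ I_{n_1}&0&0\\ 0&I_{n_2}&(s-a)I_{n_2}\end{bmatrix},$$ $$G_0(s)=\begin{bmatrix} I_{n_0}&0&0\\ 0&0&0\\ 0&0&0\end{bmatrix},\quad G_2(s,\theta)=-K(s)(BT)^{-1}BQ(s,\theta),\quad G_1(s,\theta)=\begin{bmatrix} 0&0&0\\ 0&I_{n_1}&0\\ 0&0&(s-\theta)I_{n_2}\end{bmatrix}+G_2(s,\theta).$$ *)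

theory Defs
  imports "HOL-Analysis.Analysis" "Jordan_Normal_Form.Gauss_Jordan_Elimination"
begin

text \<open>
  Dimensions are natural numbers and may be 0, so vectors and matrices are taken from
  Jordan_Normal_Form rather than from the finite-type-indexed \<open>real ^ 'n\<close>.

  Elements of \<open>L\<^sub>2\<close> and of the Sobolev spaces are represented by functions whose values on
  \<open>{a..b}\<close> are relevant; equality in these spaces is \<open>ae_eq\<close>.
\<close>

unbundle no vec_syntax
unbundle no inner_syntax

definition ae_eq :: "real \<Rightarrow> real \<Rightarrow> (real \<Rightarrow> 'a) \<Rightarrow> (real \<Rightarrow> 'a) \<Rightarrow> bool" where
  "ae_eq a b x y \<longleftrightarrow> (AE s in lebesgue_on {a..b}. x s = y s)"

definition coord :: "nat \<Rightarrow> (real \<Rightarrow> real Matrix.vec) \<Rightarrow> real \<Rightarrow> real" where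
  "coord i x = (\<lambda>s. x s $ i)"

definition block :: "nat \<Rightarrow> nat \<Rightarrow> (real \<Rightarrow> real Matrix.vec) \<Rightarrow> real \<Rightarrow> real Matrix.vec" where
  "block k m x = (\<lambda>s. Matrix.vec m (\<lambda>i. x s $ (k + i)))"

subsection \<open>The space \<open>L\<^sub>2\<close>\<close>

definition L2_real :: "real \<Rightarrow> real \<Rightarrow> (real \<Rightarrow> real) set" where
  "L2_real a b = {f. f \<in> borel_measurable (lebesgue_on {a..b}) \<and>
                     integrable (lebesgue_on {a..b}) (\<lambda>s. (f s)\<^sup>2)}"

definition L2 :: "real \<Rightarrow> real \<Rightarrow> nat \<Rightarrow> (real \<Rightarrow> real Matrix.vec) set" where
  "L2 a b m = {x. (\<forall>s\<in>{a..b}. x s \<in> carrier_vec m) \<and> (\<forall>i<m. coord i x \<in> L2_real a b)}"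

definition L2_inner ::
  "real \<Rightarrow> real \<Rightarrow> (real \<Rightarrow> real Matrix.vec) \<Rightarrow> (real \<Rightarrow> real Matrix.vec) \<Rightarrow> real" where
  "L2_inner a b x y = (LINT s|lebesgue_on {a..b}. x s \<bullet> y s)"

subsection \<open>Weak derivatives and Sobolev spaces\<close>

text \<open>\<open>C\<^sub>c\<^sup>\<infinity>\<close> of the open interval from \<open>a\<close> to \<open>b\<close>, extended by 0.\<close>

definition test_functions :: "real \<Rightarrow> real \<Rightarrow> (real \<Rightarrow> real) set" where
  "test_functions a b = {\<phi>. (\<forall>k s. (deriv ^^ k) \<phi> differentiable at s) \<and>
     (\<exists>c d. a < c \<and> d < b \<and> (\<forall>s. s \<notin> {c..d} \<longrightarrow> \<phi> s = 0))}"

definition has_weak_deriv ::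
  "real \<Rightarrow> real \<Rightarrow> nat \<Rightarrow> (real \<Rightarrow> real) \<Rightarrow> (real \<Rightarrow> real) \<Rightarrow> bool" where
  "has_weak_deriv a b k f g \<longleftrightarrow> (\<forall>\<phi>\<in>test_functions a b.
     (LINT s|lebesgue_on {a..b}. f s * (deriv ^^ k) \<phi> s) =
     (- 1) ^ k * (LINT s|lebesgue_on {a..b}. g s * \<phi> s))"

definition sobolev_real :: "real \<Rightarrow> real \<Rightarrow> nat \<Rightarrow> (real \<Rightarrow> real) set" where
  "sobolev_real a b k =
     {f \<in> L2_real a b. \<forall>j\<le>k. \<exists>g\<in>L2_real a b. has_weak_deriv a b j f g}"

definition sobolev :: "real \<Rightarrow> real \<Rightarrow> nat \<Rightarrow> nat \<Rightarrow> (real \<Rightarrow> real Matrix.vec) set" where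
  "sobolev a b k m =
     {x. (\<forall>s\<in>{a..b}. x s \<in> carrier_vec m) \<and> (\<forall>i<m. coord i x \<in> sobolev_real a b k)}"

text \<open>The choices below are unique, respectively up to null sets and on \<open>{a..b}\<close>.\<close>

definition weak_deriv_real :: "real \<Rightarrow> real \<Rightarrow> nat \<Rightarrow> (real \<Rightarrow> real) \<Rightarrow> real \<Rightarrow> real" where
  "weak_deriv_real a b k f = (SOME g. g \<in> L2_real a b \<and> has_weak_deriv a b k f g)"

definition cont_version_real :: "real \<Rightarrow> real \<Rightarrow> (real \<Rightarrow> real) \<Rightarrow> real \<Rightarrow> real" where
  "cont_version_real a b f = (SOME g. continuous_on {a..b} g \<and> ae_eq a b g f)"

definition weak_deriv ::
  "real \<Rightarrow> real \<Rightarrow> nat \<Rightarrow> nat \<Rightarrow> (real \<Rightarrow> real Matrix.vec) \<Rightarrow> real \<Rightarrow> real Matrix.vec" where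
  "weak_deriv a b k m x = (\<lambda>s. Matrix.vec m (\<lambda>i. weak_deriv_real a b k (coord i x) s))"

text \<open>Point values of Sobolev functions are those of the continuous representative.\<close>

definition cont_version ::
  "real \<Rightarrow> real \<Rightarrow> nat \<Rightarrow> (real \<Rightarrow> real Matrix.vec) \<Rightarrow> real \<Rightarrow> real Matrix.vec" where
  "cont_version a b m x = (\<lambda>s. Matrix.vec m (\<lambda>i. cont_version_real a b (coord i x) s))"

subsection \<open>3-PI operators\<close>

definition vec_integral :: "nat \<Rightarrow> real set \<Rightarrow> (real \<Rightarrow> real Matrix.vec) \<Rightarrow> real Matrix.vec" where
  "vec_integral m S h = Matrix.vec m (\<lambda>i. LINT \<theta>|lebesgue_on S. h \<theta> $ i)"

text \<open>\<open>m\<close> is the number of rows of the parameters.\<close>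

definition PI_op :: "real \<Rightarrow> real \<Rightarrow> nat \<Rightarrow>
    (real \<Rightarrow> real mat) \<Rightarrow> (real \<Rightarrow> real \<Rightarrow> real mat) \<Rightarrow> (real \<Rightarrow> real \<Rightarrow> real mat) \<Rightarrow>
    (real \<Rightarrow> real Matrix.vec) \<Rightarrow> real \<Rightarrow> real Matrix.vec" where
  "PI_op a b m N0 N1 N2 x = (\<lambda>s.
     N0 s *\<^sub>v x s
     + vec_integral m {a..s} (\<lambda>\<theta>. N1 s \<theta> *\<^sub>v x \<theta>)
     + vec_integral m {s..b} (\<lambda>\<theta>. N2 s \<theta> *\<^sub>v x \<theta>))"

subsection \<open>The block matrices\<close>

definition append_cols :: "real mat \<Rightarrow> real mat \<Rightarrow> real mat" (infixr \<open>@\<^sub>c\<close> 68) where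
  "A @\<^sub>c B = four_block_mat A B (0\<^sub>m 0 (dim_col A)) (0\<^sub>m 0 (dim_col B))"

definition T_mat :: "real \<Rightarrow> real \<Rightarrow> nat \<Rightarrow> nat \<Rightarrow> real mat" where
  "T_mat a b n1 n2 =
      (1\<^sub>m n1    @\<^sub>c 0\<^sub>m n1 n2 @\<^sub>c 0\<^sub>m n1 n2)
   @\<^sub>r (1\<^sub>m n1    @\<^sub>c 0\<^sub>m n1 n2 @\<^sub>c 0\<^sub>m n1 n2)
   @\<^sub>r (0\<^sub>m n2 n1 @\<^sub>c 1\<^sub>m n2    @\<^sub>c 0\<^sub>m n2 n2)
   @\<^sub>r (0\<^sub>m n2 n1 @\<^sub>c 1\<^sub>m n2    @\<^sub>c (b - a) \<cdot>\<^sub>m 1\<^sub>m n2)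
   @\<^sub>r (0\<^sub>m n2 n1 @\<^sub>c 0\<^sub>m n2 n2 @\<^sub>c 1\<^sub>m n2)
   @\<^sub>r (0\<^sub>m n2 n1 @\<^sub>c 0\<^sub>m n2 n2 @\<^sub>c 1\<^sub>m n2)"

definition Q_mat :: "real \<Rightarrow> nat \<Rightarrow> nat \<Rightarrow> nat \<Rightarrow> real \<Rightarrow> real \<Rightarrow> real mat" where
  "Q_mat b n0 n1 n2 s \<theta> =
      (0\<^sub>m n1 n0 @\<^sub>c 0\<^sub>m n1 n1 @\<^sub>c 0\<^sub>m n1 n2)
   @\<^sub>r (0\<^sub>m n1 n0 @\<^sub>c 1\<^sub>m n1    @\<^sub>c 0\<^sub>m n1 n2)
   @\<^sub>r (0\<^sub>m n2 n0 @\<^sub>c 0\<^sub>m n2 n1 @\<^sub>c 0\<^sub>m n2 n2)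
   @\<^sub>r (0\<^sub>m n2 n0 @\<^sub>c 0\<^sub>m n2 n1 @\<^sub>c (b - \<theta>) \<cdot>\<^sub>m 1\<^sub>m n2)
   @\<^sub>r (0\<^sub>m n2 n0 @\<^sub>c 0\<^sub>m n2 n1 @\<^sub>c 0\<^sub>m n2 n2)
   @\<^sub>r (0\<^sub>m n2 n0 @\<^sub>c 0\<^sub>m n2 n1 @\<^sub>c 1\<^sub>m n2)"

definition K_mat :: "real \<Rightarrow> nat \<Rightarrow> nat \<Rightarrow> nat \<Rightarrow> real \<Rightarrow> real mat" where
  "K_mat a n0 n1 n2 s =
      (0\<^sub>m n0 n1 @\<^sub>c 0\<^sub>m n0 n2 @\<^sub>c 0\<^sub>m n0 n2)
   @\<^sub>r (1\<^sub>m n1    @\<^sub>c 0\<^sub>m n1 n2 @\<^sub>c 0\<^sub>m n1 n2)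
   @\<^sub>r (0\<^sub>m n2 n1 @\<^sub>c 1\<^sub>m n2    @\<^sub>c (s - a) \<cdot>\<^sub>m 1\<^sub>m n2)"

definition G0 :: "nat \<Rightarrow> nat \<Rightarrow> nat \<Rightarrow> real \<Rightarrow> real mat" where
  "G0 n0 n1 n2 s =
      (1\<^sub>m n0    @\<^sub>c 0\<^sub>m n0 n1 @\<^sub>c 0\<^sub>m n0 n2)
   @\<^sub>r (0\<^sub>m n1 n0 @\<^sub>c 0\<^sub>m n1 n1 @\<^sub>c 0\<^sub>m n1 n2)
   @\<^sub>r (0\<^sub>m n2 n0 @\<^sub>c 0\<^sub>m n2 n1 @\<^sub>c 0\<^sub>m n2 n2)"

definition G2 ::
  "real \<Rightarrow> real \<Rightarrow> nat \<Rightarrow> nat \<Rightarrow> nat \<Rightarrow> real mat \<Rightarrow> real \<Rightarrow> real \<Rightarrow> real mat" where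
  "G2 a b n0 n1 n2 B s \<theta> =
     - (K_mat a n0 n1 n2 s * the (mat_inverse (B * T_mat a b n1 n2)) * B * Q_mat b n0 n1 n2 s \<theta>)"

definition G1 ::
  "real \<Rightarrow> real \<Rightarrow> nat \<Rightarrow> nat \<Rightarrow> nat \<Rightarrow> real mat \<Rightarrow> real \<Rightarrow> real \<Rightarrow> real mat" where
  "G1 a b n0 n1 n2 B s \<theta> =
     (   (0\<^sub>m n0 n0 @\<^sub>c 0\<^sub>m n0 n1 @\<^sub>c 0\<^sub>m n0 n2)
      @\<^sub>r (0\<^sub>m n1 n0 @\<^sub>c 1\<^sub>m n1    @\<^sub>c 0\<^sub>m n1 n2)
      @\<^sub>r (0\<^sub>m n2 n0 @\<^sub>c 0\<^sub>m n2 n1 @\<^sub>c (s - \<theta>) \<cdot>\<^sub>m 1\<^sub>m n2))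
     + G2 a b n0 n1 n2 B s \<theta>"

subsection \<open>The space \<open>X\<close> and the operator\<close>

text \<open>
  A triple \<open>(x\<^sub>0, x\<^sub>1, x\<^sub>2)\<close> is represented by the stacked vector-valued function, whose
  components are its blocks.
\<close>

definition X_space ::
  "real \<Rightarrow> real \<Rightarrow> nat \<Rightarrow> nat \<Rightarrow> nat \<Rightarrow> real mat \<Rightarrow> (real \<Rightarrow> real Matrix.vec) set" where
  "X_space a b n0 n1 n2 B = {x. (\<forall>s\<in>{a..b}. x s \<in> carrier_vec (n0 + n1 + n2)) \<and>
     (let x0 = block 0 n0 x; x1 = block n0 n1 x; x2 = block (n0 + n1) n2 x;
          u1 = cont_version a b n1 x1;
          u2 = cont_version a b n2 x2;
          u2s = cont_version a b n2 (weak_deriv a b 1 n2 x2)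
      in x0 \<in> L2 a b n0 \<and> x1 \<in> sobolev a b 1 n1 \<and> x2 \<in> sobolev a b 2 n2 \<and>
         B *\<^sub>v (u1 a @\<^sub>v u1 b @\<^sub>v u2 a @\<^sub>v u2 b @\<^sub>v u2s a @\<^sub>v u2s b)
           = 0\<^sub>v (n1 + 2 * n2))}"

definition X_inner :: "real \<Rightarrow> real \<Rightarrow> nat \<Rightarrow> nat \<Rightarrow> nat \<Rightarrow>
    (real \<Rightarrow> real Matrix.vec) \<Rightarrow> (real \<Rightarrow> real Matrix.vec) \<Rightarrow> real" where
  "X_inner a b n0 n1 n2 x y =
     L2_inner a b (block 0 n0 x) (block 0 n0 y)
     + L2_inner a b (weak_deriv a b 1 n1 (block n0 n1 x)) (weak_deriv a b 1 n1 (block n0 n1 y))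
     + L2_inner a b (weak_deriv a b 2 n2 (block (n0 + n1) n2 x))
                    (weak_deriv a b 2 n2 (block (n0 + n1) n2 y))"

definition T_op :: "real \<Rightarrow> real \<Rightarrow> nat \<Rightarrow> nat \<Rightarrow> nat \<Rightarrow> real mat \<Rightarrow>
    (real \<Rightarrow> real Matrix.vec) \<Rightarrow> real \<Rightarrow> real Matrix.vec" where
  "T_op a b n0 n1 n2 B =
     PI_op a b (n0 + n1 + n2) (G0 n0 n1 n2) (G1 a b n0 n1 n2 B) (G2 a b n0 n1 n2 B)"

text \<open>
  A unitary map from (\<open>V\<close>, \<open>ip\<close>) onto (\<open>W\<close>, \<open>ip'\<close>), both spaces consisting of functions modulo
  \<open>ae_eq\<close>. The second conjunct says that \<open>U\<close> is well defined on equivalence classes.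
\<close>

definition unitary_map :: "real \<Rightarrow> real \<Rightarrow>
    (real \<Rightarrow> real Matrix.vec) set \<Rightarrow>
    ((real \<Rightarrow> real Matrix.vec) \<Rightarrow> (real \<Rightarrow> real Matrix.vec) \<Rightarrow> real) \<Rightarrow>
    (real \<Rightarrow> real Matrix.vec) set \<Rightarrow>
    ((real \<Rightarrow> real Matrix.vec) \<Rightarrow> (real \<Rightarrow> real Matrix.vec) \<Rightarrow> real) \<Rightarrow>
    ((real \<Rightarrow> real Matrix.vec) \<Rightarrow> (real \<Rightarrow> real Matrix.vec)) \<Rightarrow> bool" where
  "unitary_map a b V ip W ip' U \<longleftrightarrow>
     (\<forall>x\<in>V. U x \<in> W) \<and>
     (\<forall>x\<in>V. \<forall>y\<in>V. ae_eq a b x y \<longrightarrow> ae_eq a b (U x) (U y)) \<and>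
     (\<forall>x\<in>V. \<forall>y\<in>V. ae_eq a b (U (\<lambda>s. x s + y s)) (\<lambda>s. U x s + U y s)) \<and>
     (\<forall>c. \<forall>x\<in>V. ae_eq a b (U (\<lambda>s. c \<cdot>\<^sub>v x s)) (\<lambda>s. c \<cdot>\<^sub>v U x s)) \<and>
     (\<forall>w\<in>W. \<exists>x\<in>V. ae_eq a b (U x) w) \<and>
     (\<forall>x\<in>V. \<forall>y\<in>V. ip' (U x) (U y) = ip x y)"

end

theory Submission
  imports Defs "HOL-Real_Asymp.Real_Asymp"
begin

text \<open>
  Componentwise, \<open>H\<^sub>1\<close> functions are exactly \<open>c + \<integral>\<^sub>a\<^sup>s f\<close> and \<open>H\<^sub>2\<close> functions are exactly
  \<open>d + (s - a) e + \<integral>\<^sub>a\<^sup>s (s - \<theta>) f(\<theta>) d\<theta>\<close> with \<open>f \<in> L\<^sub>2\<close> the weak derivative (du Bois-Reymond).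
  For such an \<open>\<^bold>x\<close> with constants of integration \<open>v = (c, d, e)\<close>, the vector of boundary values is
  \<open>T v + q\<close> with \<open>q = \<integral>\<^sub>a\<^sup>b Q f\<close>, so the boundary condition holds iff \<open>v = - (B T)\<^sup>-\<^sup>1 B q\<close>. This is
  precisely the choice of constants made by \<open>\<T>\<close>; hence \<open>\<T>\<close> is onto \<open>X\<close>, and
  since it inverts \<open>(x\<^sub>0, x\<^sub>1, x\<^sub>2) \<mapsto> (x\<^sub>0, \<partial>\<^sub>s x\<^sub>1, \<partial>\<^sub>s\<^sup>2 x\<^sub>2)\<close>, it preserves the inner product.
\<close>

subsection \<open>Smooth functions and bumps\<close>

text \<open>Weak derivatives and point values are defined by \<open>SOME\<close>, so a function in
  \<open>X\<close> is accessible only up to null sets. The relation \<open>represents x v w\<close>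
  is designed for this: it fixes \<open>w\<close> only almost everywhere, yet determines all that
  \<open>X_space\<close> and \<open>X_inner\<close> read from \<open>w\<close>, and it is linear in
  the triple. Every clause of unitarity becomes a fact about pairs \<open>(x, v)\<close>:
  differentiation forgets \<open>v\<close>, and the boundary condition fixes \<open>v\<close>. The
  kernels have two origins. Cauchy's formula turns a double integral into a single one with weight
  \<open>s - \<theta>\<close>, or \<open>b - \<theta>\<close> at the right end point. And
  \<open>G1\<close> and \<open>G2\<close> share the summand built from \<open>K_mat\<close>, the
  inverse of \<open>B * T_mat\<close> and \<open>Q_mat\<close>, so its integrals over
  \<open>{a..s}\<close> and \<open>{s..b}\<close> merge into one over \<open>{a..b}\<close>; that is
  how constants depending on all of \<open>x\<close> enter a Volterra-type formula. The analytic
  obstacle is the passage from weak derivatives, tested only against smooth functions supported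
  inside the interval, to primitives. It rests on bump functions made from
  \<open>exp (- (1 / s))\<close> and on one exchange of integrals over a triangle.\<close>

definition smooth :: "(real \<Rightarrow> real) \<Rightarrow> bool" where
  "smooth f \<longleftrightarrow> (\<forall>k s. (deriv ^^ k) f differentiable at s)"

text \<open>If a class is closed under taking derivatives, every iterated derivative of a member
  stays in it and is therefore differentiable. Smoothness proofs thus reduce to exhibiting a class
  that is stable under a single derivative; no formula for the \<open>k\<close>-th derivative is
  ever written.\<close>

lemma smooth_coinduct:
  assumes "f \<in> C"
    and step: "\<And>g. g \<in> C \<Longrightarrow> \<exists>g'\<in>C. \<forall>s. (g has_real_derivative g' s) (at s)"
  shows "smooth f"
proof -
  have "(deriv ^^ k) f \<in> C" for k
  proof (induction k)
    case (Suc k)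
    obtain g' where g': "g' \<in> C" "\<And>s. ((deriv ^^ k) f has_real_derivative g' s) (at s)"
      using step[OF Suc] by blast
    then have "(deriv ^^ Suc k) f = g'"
      by (auto simp: DERIV_imp_deriv)
    then show ?case using g' by simp
  qed (use assms in simp)
  then show ?thesis
    unfolding smooth_def by (meson real_differentiable_def step)
qed

lemma smooth_has_deriv:
  assumes "smooth f" shows "(f has_real_derivative deriv f s) (at s)"
  using assms[unfolded smooth_def, rule_format, of 0 s]
  by (auto simp: real_differentiable_def DERIV_imp_deriv)

lemma smooth_deriv: "smooth f \<Longrightarrow> smooth (deriv f)"
  unfolding smooth_def by (metis comp_apply funpow_Suc_right)

lemma smooth_continuous_on: "smooth f \<Longrightarrow> continuous_on S f"
  by (meson DERIV_continuous continuous_at_imp_continuous_on smooth_has_deriv)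

lemma smooth_antideriv:
  assumes "\<And>s. (f has_real_derivative g s) (at s)" "smooth g"
  shows "smooth f"
proof (rule smooth_coinduct[where C = "insert f {h. smooth h}"])
  fix h assume "h \<in> insert f {h. smooth h}"
  then show "\<exists>h'\<in>insert f {h. smooth h}. \<forall>s. (h has_real_derivative h' s) (at s)"
    using assms smooth_has_deriv smooth_deriv by (metis insert_iff mem_Collect_eq)
qed simp

lemma smooth_add:
  assumes "smooth f" "smooth g" shows "smooth (\<lambda>s. f s + g s)"
proof (rule smooth_coinduct[where C = "{\<lambda>s. f s + g s | f g. smooth f \<and> smooth g}"])
  fix h assume "h \<in> {\<lambda>s. f s + g s | f g. smooth f \<and> smooth g}"
  then obtain f g where h: "h = (\<lambda>s. f s + g s)" "smooth f" "smooth g" by blast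
  show "\<exists>h'\<in>{\<lambda>s. f s + g s | f g. smooth f \<and> smooth g}. \<forall>s. (h has_real_derivative h' s) (at s)"
    by (rule bexI[of _ "\<lambda>s. deriv f s + deriv g s"])
      (use h in \<open>auto intro!: derivative_eq_intros smooth_has_deriv smooth_deriv\<close>)
qed (use assms in auto)

text \<open>Products alone are not stable under differentiation, since the product rule yields a sum
  of two of them. Closing under sums gives a class to which \<open>smooth_coinduct\<close>
  applies.\<close>

inductive_set prod_sums :: "(real \<Rightarrow> real) set" where
  prod: "smooth f \<Longrightarrow> smooth g \<Longrightarrow> (\<lambda>s. f s * g s) \<in> prod_sums"
| sum: "u \<in> prod_sums \<Longrightarrow> v \<in> prod_sums \<Longrightarrow> (\<lambda>s. u s + v s) \<in> prod_sums"

lemma smooth_mult: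
  assumes "smooth f" "smooth g" shows "smooth (\<lambda>s. f s * g s)"
proof (rule smooth_coinduct[where C = prod_sums])
  fix h assume "h \<in> prod_sums"
  then show "\<exists>h'\<in>prod_sums. \<forall>s. (h has_real_derivative h' s) (at s)"
  proof induction
    case (prod f g)
    then have "(\<lambda>s. deriv f s * g s + f s * deriv g s) \<in> prod_sums"
      by (intro prod_sums.intros smooth_deriv)
    then show ?case
      by (rule bexI[rotated]) (use prod in \<open>auto intro!: derivative_eq_intros smooth_has_deriv\<close>)
  next
    case (sum u v)
    then obtain u' v' where "u' \<in> prod_sums" "v' \<in> prod_sums"
      "\<forall>s. (u has_real_derivative u' s) (at s)" "\<forall>s. (v has_real_derivative v' s) (at s)"
      by blast
    then show ?case
      by (intro bexI[of _ "\<lambda>s. u' s + v' s"]) (auto intro: DERIV_add prod_sums.sum)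
  qed
qed (use assms in \<open>auto intro: prod_sums.prod\<close>)

lemma smooth_const: "smooth (\<lambda>_. c)"
  by (rule smooth_coinduct[where C = "range (\<lambda>c _. c)"]) (auto intro!: exI[of _ 0])

text \<open>The free factor \<open>k\<close> in the class absorbs the factor \<open>c\<close> that
  the chain rule contributes at every differentiation.\<close>

lemma smooth_compose_affine:
  assumes "smooth f" shows "smooth (\<lambda>s. f (c * s + d))"
proof (rule smooth_coinduct[where C = "{\<lambda>s. k * f (c * s + d) | k f. smooth f}"])
  fix h assume "h \<in> {\<lambda>s. k * f (c * s + d) | k f. smooth f}"
  then obtain k f where h: "h = (\<lambda>s. k * f (c * s + d))" "smooth f" by blast
  have "(h has_real_derivative (k * c) * deriv f (c * s + d)) (at s)" for s
    unfolding h by (auto intro!: derivative_eq_intros DERIV_chain2[OF smooth_has_deriv[OF h(2)]])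
  then show "\<exists>h'\<in>{\<lambda>s. k * f (c * s + d) | k f. smooth f}. \<forall>s. (h has_real_derivative h' s) (at s)"
    using smooth_deriv[OF h(2)]
    by (intro bexI[of _ "\<lambda>s. (k * c) * deriv f (c * s + d)"] CollectI exI[of _ "k * c"] exI[of _ "deriv f"]) auto
qed (use assms in \<open>auto intro!: exI[of _ 1] exI[of _ f]\<close>)

text \<open>The class of functions \<open>p (1/s) exp (-1/s)\<close>, with \<open>p\<close> a polynomial, is closed under
  differentiation.\<close>

definition flat_exp :: "real poly \<Rightarrow> real \<Rightarrow> real" where
  "flat_exp p s = (if s \<le> 0 then 0 else poly p (1 / s) * exp (- (1 / s)))"

text \<open>The quotient is the right difference quotient of \<open>flat_exp p\<close> at 0. With
  \<open>1 / s\<close> tending to infinity, exponential decay beats each power, hence each of the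
  finitely many terms of the polynomial.\<close>

lemma flat_exp_over_tendsto_0: "((\<lambda>s. flat_exp p s / s) \<longlongrightarrow> 0) (at_right 0)"
proof -
  have mono: "((\<lambda>s. (1 / s) ^ n * exp (- (1 / s))) \<longlongrightarrow> 0) (at_right (0::real))" for n
    by real_asymp
  have "((\<lambda>s. \<Sum>i\<le>degree p. coeff p i * ((1 / s) ^ Suc i * exp (- (1 / s)))) \<longlongrightarrow>
          (\<Sum>i\<le>degree p. coeff p i * 0)) (at_right 0)"
    by (intro tendsto_sum tendsto_mult_left mono)
  moreover have "\<forall>\<^sub>F s in at_right 0.
      (\<Sum>i\<le>degree p. coeff p i * ((1 / s) ^ Suc i * exp (- (1 / s)))) = flat_exp p s / s"
    using eventually_at_right_less[of 0]
    by eventually_elim (simp add: flat_exp_def poly_altdef sum_distrib_left sum_divide_distrib power_one_over mult_ac)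
  ultimately show ?thesis
    by (simp add: filterlim_cong)
qed

text \<open>Put \<open>u = 1 / s\<close>, so that \<open>du/ds = - u^2\<close>. Then the derivative
  of \<open>p(u) exp(-u)\<close> is \<open>u^2 (p(u) - p'(u)) exp(-u)\<close>, and
  \<open>[:0, 0, 1:]\<close> is the polynomial \<open>u^2\<close>. The point 0 is handled by
  difference quotients from either side.\<close>

lemma flat_exp_has_deriv:
  "(flat_exp p has_real_derivative flat_exp ([:0, 0, 1:] * (p - pderiv p)) s) (at s)"
proof (cases s "0::real" rule: linorder_cases)
  case less
  have "((\<lambda>_. 0) has_real_derivative 0) (at s)" by simp
  \<comment> \<open>Left of 0 both the function and the claimed derivative vanish;
    \<open>back_subst\<close> writes the literal 0 as the required \<open>flat_exp\<close>
    value.\<close>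
  then show ?thesis
    by (rule has_field_derivative_transform_within_open[where S = "{..<0}", THEN back_subst[of "\<lambda>x. (_ has_real_derivative x) _"]])
      (use less in \<open>auto simp: flat_exp_def\<close>)
next
  case greater
  have "((\<lambda>s. poly p (1 / s) * exp (- (1 / s))) has_real_derivative
      flat_exp ([:0, 0, 1:] * (p - pderiv p)) s) (at s)"
    using greater
    by (auto intro!: derivative_eq_intros DERIV_chain2[OF poly_DERIV]
        simp: flat_exp_def field_simps power2_eq_square)
  then show ?thesis
    by (rule has_field_derivative_transform_within_open[where S = "{0<..}"])
      (use greater in \<open>auto simp: flat_exp_def\<close>)
next
  case equal
  have "((\<lambda>h. flat_exp p h / h) \<longlongrightarrow> 0) (at_left 0)"
    by (rule tendsto_eventually) (auto simp: eventually_at_left_field flat_exp_def intro: exI[of _ "-1"])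
  then have "((\<lambda>h. flat_exp p h / h) \<longlongrightarrow> 0) (at 0)"
    using flat_exp_over_tendsto_0 filterlim_split_at by blast
  then show ?thesis
    using equal by (simp add: DERIV_def flat_exp_def)
qed

lemma smooth_flat_exp: "smooth (flat_exp p)"
  by (rule smooth_coinduct[where C = "range flat_exp"]) (use flat_exp_has_deriv in blast)+

lemma flat_exp_1_bounds: "0 \<le> flat_exp 1 s" "flat_exp 1 s \<le> 1"
  by (auto simp: flat_exp_def)

text \<open>Compressing the argument by \<open>n\<close> turns the flat function into a Heaviside
  step: \<open>1 / (n s)\<close> tends to 0 for positive \<open>s\<close>, and all terms are 0
  otherwise.\<close>

lemma flat_exp_1_scaled_tendsto:
  "(\<lambda>n. flat_exp 1 (real n * s)) \<longlonglongrightarrow> (if s > 0 then 1 else 0)"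
proof (cases "s > 0")
  case True
  have "(\<lambda>n. exp (- (1 / (real n * s)))) \<longlonglongrightarrow> 1"
    using True by real_asymp
  moreover have "\<forall>\<^sub>F n in sequentially. exp (- (1 / (real n * s))) = flat_exp 1 (real n * s)"
    using eventually_gt_at_top[of 0]
    by eventually_elim (use True in \<open>auto simp: flat_exp_def mult_le_0_iff\<close>)
  ultimately show ?thesis
    using True by (simp add: filterlim_cong)
next
  case False
  then have "flat_exp 1 (real n * s) = 0" for n
    by (auto simp: flat_exp_def mult_le_0_iff zero_less_mult_iff)
  then show ?thesis using False by simp
qed

text \<open>The parameter \<open>n\<close> controls steepness only: the support stays within
  \<open>{c..d}\<close> for all \<open>n\<close>, while the values approach the indicator of the
  open interval. For \<open>n = 0\<close> the function is identically 0.\<close>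

definition bump :: "real \<Rightarrow> real \<Rightarrow> nat \<Rightarrow> real \<Rightarrow> real" where
  "bump c d n s = flat_exp 1 (real n * (s - c)) * flat_exp 1 (real n * (d - s))"

lemma smooth_bump: "smooth (bump c d n)"
proof -
  have "smooth (\<lambda>s. flat_exp 1 (real n * s + (- real n * c)) * flat_exp 1 ((- real n) * s + real n * d))"
    by (intro smooth_mult smooth_compose_affine smooth_flat_exp)
  moreover have "bump c d n = (\<lambda>s. flat_exp 1 (real n * s + (- real n * c)) * flat_exp 1 ((- real n) * s + real n * d))"
    by (auto simp: bump_def algebra_simps)
  ultimately show ?thesis by simp
qed

lemma bump_eq_0: "s \<notin> {c..d} \<Longrightarrow> bump c d n s = 0"
  by (auto simp: bump_def flat_exp_def mult_le_0_iff zero_less_mult_iff)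

lemma bump_bounds: "0 \<le> bump c d n s" "bump c d n s \<le> 1"
  by (auto simp: bump_def flat_exp_1_bounds mult_le_one)

lemma bump_pos: "c < s \<Longrightarrow> s < d \<Longrightarrow> n > 0 \<Longrightarrow> 0 < bump c d n s"
  by (auto simp: bump_def flat_exp_def zero_less_mult_iff not_le mult_le_0_iff)

lemma bump_tendsto: "(\<lambda>n. bump c d n s) \<longlonglongrightarrow> indicator {c<..<d} s"
proof -
  have "(\<lambda>n. bump c d n s) \<longlonglongrightarrow> (if s - c > 0 then 1 else 0) * (if d - s > 0 then 1 else 0)"
    unfolding bump_def by (intro tendsto_mult flat_exp_1_scaled_tendsto)
  then show ?thesis by (auto simp: indicator_def split: if_splits)
qed

subsection \<open>The lemma of du Bois-Reymond\<close>

lemma test_functions_iff: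
  "\<phi> \<in> test_functions a b \<longleftrightarrow>
    smooth \<phi> \<and> (\<exists>c d. a < c \<and> d < b \<and> (\<forall>s. s \<notin> {c..d} \<longrightarrow> \<phi> s = 0))"
  by (simp add: test_functions_def smooth_def)

lemma test_functions_endpoints: "\<phi> \<in> test_functions a b \<Longrightarrow> \<phi> a = 0 \<and> \<phi> b = 0"
  by (auto simp: test_functions_iff)

lemma test_functions_continuous_on: "\<phi> \<in> test_functions a b \<Longrightarrow> continuous_on S \<phi>"
  by (simp add: test_functions_iff smooth_continuous_on)

lemma test_functions_has_deriv:
  "\<phi> \<in> test_functions a b \<Longrightarrow> (\<phi> has_real_derivative deriv \<phi> s) (at s)"
  by (simp add: test_functions_iff smooth_has_deriv)

text \<open>The same support interval works: its complement is open, so \<open>\<phi>\<close>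
  vanishes in a neighbourhood of every point outside.\<close>

lemma test_functions_deriv:
  assumes "\<phi> \<in> test_functions a b" shows "deriv \<phi> \<in> test_functions a b"
proof -
  obtain c d where cd: "a < c" "d < b" "\<And>s. s \<notin> {c..d} \<Longrightarrow> \<phi> s = 0"
    using assms by (auto simp: test_functions_iff)
  have "deriv \<phi> s = 0" if "s \<notin> {c..d}" for s
  proof -
    have "\<forall>\<^sub>F t in nhds s. t \<in> - {c..d}"
      using that by (intro eventually_nhds_in_open) (auto simp: open_Compl)
    then have "\<forall>\<^sub>F t in nhds s. \<phi> t = 0"
      by (rule eventually_mono) (use cd(3) in blast)
    then have "deriv \<phi> s = deriv (\<lambda>_. 0) s"
      by (rule deriv_cong_ev) simp
    then show ?thesis by simp
  qed
  then show ?thesis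
    using assms cd by (auto simp: test_functions_iff smooth_deriv)
qed

lemma bump_in_test_functions: "a < c \<Longrightarrow> d < b \<Longrightarrow> bump c d n \<in> test_functions a b"
  unfolding test_functions_iff using smooth_bump bump_eq_0 by blast

lemma test_functions_add_scaled:
  assumes "\<phi> \<in> test_functions a b" "\<psi> \<in> test_functions a b"
  shows "(\<lambda>s. \<phi> s + k * \<psi> s) \<in> test_functions a b"
proof -
  obtain c d where "a < c" "d < b" "\<forall>s. s \<notin> {c..d} \<longrightarrow> \<phi> s = 0"
    using assms(1) unfolding test_functions_iff by blast
  moreover obtain c' d' where "a < c'" "d' < b" "\<forall>s. s \<notin> {c'..d'} \<longrightarrow> \<psi> s = 0"
    using assms(2) unfolding test_functions_iff by blast
  ultimately have "a < min c c'" "max d d' < b"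
    and "\<forall>s. s \<notin> {min c c'..max d d'} \<longrightarrow> s \<notin> {c..d} \<and> s \<notin> {c'..d'}"
    and "\<forall>s. s \<notin> {c..d} \<and> s \<notin> {c'..d'} \<longrightarrow> \<phi> s + k * \<psi> s = 0"
    by auto
  moreover have "smooth (\<lambda>s. \<phi> s + k * \<psi> s)"
    using assms by (intro smooth_add smooth_mult smooth_const) (auto simp: test_functions_iff)
  ultimately show ?thesis
    unfolding test_functions_iff by blast
qed

lemma integrable_mult_continuous_on:
  fixes f g :: "real \<Rightarrow> real"
  assumes f: "integrable (lebesgue_on {a..b}) f" and g: "continuous_on {a..b} g"
  shows "integrable (lebesgue_on {a..b}) (\<lambda>s. f s * g s)"
proof -
  obtain M where M: "\<And>s. s \<in> {a..b} \<Longrightarrow> norm (g s) \<le> M"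
    using compact_imp_bounded[OF compact_continuous_image[OF g]] unfolding bounded_iff by blast
  have "g \<in> borel_measurable (lebesgue_on {a..b})"
    by (rule continuous_imp_measurable_on_sets_lebesgue[OF g]) simp
  then show ?thesis
    using f by (intro Bochner_Integration.integrable_bound[OF integrable_mult_right[OF f, of M]])
      (auto intro!: AE_I2 mult_right_mono order_trans[OF M abs_ge_self, unfolded real_norm_def]
        simp: abs_mult mult.commute[of "\<bar>f _\<bar>"])
qed

text \<open>By Lebesgue differentiation, at almost every \<open>x\<close> the averages of
  \<open>f\<close> over \<open>{x..x + h}\<close> converge to \<open>f x\<close> as \<open>h\<close>
  decreases to 0; by assumption these averages are all 0.\<close>

lemma AE_eq_0_if_subinterval_integrals_0:
  fixes f :: "real \<Rightarrow> real"
  assumes f: "integrable (lebesgue_on {a..b}) f"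
    and 0: "\<And>c d. a < c \<Longrightarrow> c < d \<Longrightarrow> d < b \<Longrightarrow> integral {c..d} f = 0"
  shows "AE s in lebesgue_on {a..b}. f s = 0"
proof -
  \<comment> \<open>The differentiation theorem asks for integrability on every box, hence the
    extension by 0.\<close>
  let ?F = "\<lambda>s. if s \<in> {a..b} then f s else 0"
  have "f integrable_on {a..b}" by (simp add: f integrable_on_lebesgue_on)
  then have int: "?F integrable_on cbox c d" for c d
    by (intro integrable_on_subcbox[where a=c and b=d and S=UNIV])
      (simp_all add: Henstock_Kurzweil_Integration.integrable_restrict_UNIV del: atLeastAtMost_iff)
  obtain N where N: "negligible N"
    "\<And>x e. x \<notin> N \<Longrightarrow> 0 < e \<Longrightarrow> \<exists>d>0. \<forall>h. 0 < h \<and> h < d \<longrightarrow>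
        norm (integral (cbox x (x + h *\<^sub>R One)) ?F /\<^sub>R h ^ DIM(real) - ?F x) < e"
  proof (rule integrable_ccontinuous_explicit[OF int], goal_cases)
    case (1 N)
    show thesis by (rule 1(1)[OF 1(2,3)])
  qed
  have zero: "f x = 0" if x: "a < x" "x < b" "x \<notin> N" for x
  proof (rule ccontr)
    \<comment> \<open>The tolerance is taken to be the absolute value of \<open>f x\<close> itself:
      an average equal to 0 misses \<open>f x\<close> by exactly this amount, which contradicts the
      strict bound.\<close>
    assume "f x \<noteq> 0"
    then obtain d where d: "d > 0" "\<And>h. 0 < h \<and> h < d \<Longrightarrow>
        norm (integral (cbox x (x + h *\<^sub>R One)) ?F /\<^sub>R h ^ DIM(real) - ?F x) < \<bar>f x\<bar>"
      using N(2)[OF x(3), of "\<bar>f x\<bar>"] by auto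
    \<comment> \<open>Halving the minimum makes \<open>h\<close> strictly smaller than both bounds,
      so that \<open>{x..x + h}\<close> ends before \<open>b\<close>.\<close>
    define h where "h = min d (b - x) / 2"
    have h: "0 < h" "h < d" "x + h < b"
      using d(1) x by (auto simp: h_def min_def field_simps)
    have "integral {x..x + h} ?F = integral {x..x + h} f"
      using x h by (intro Henstock_Kurzweil_Integration.integral_cong) auto
    also have "\<dots> = 0" using 0 x h by simp
    finally show False
      using d(2)[of h] h x by simp
  qed
  have "AE s in lebesgue. s \<in> {a..b} \<longrightarrow> f s = 0"
    unfolding eventually_ae_filter_negligible
    by (rule exI[of _ "insert a (insert b N)"]) (use N(1) zero in force)
  then show ?thesis
    by (subst AE_restrict_space_iff) auto
qed

text \<open>Testing with \<open>bump c d n\<close> and letting \<open>n\<close> grow, with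
  \<open>\<bar>f\<bar>\<close> as dominating function, shows that the integral of \<open>f\<close>
  over each inner subinterval is 0. The preceding lemma then applies.\<close>

lemma fundamental_lemma_calculus_of_variations:
  assumes f: "integrable (lebesgue_on {a..b}) f"
    and 0: "\<And>\<phi>. \<phi> \<in> test_functions a b \<Longrightarrow> (LINT s|lebesgue_on {a..b}. f s * \<phi> s) = 0"
  shows "AE s in lebesgue_on {a..b}. f s = 0"
proof (rule AE_eq_0_if_subinterval_integrals_0[OF f])
  fix c d assume cd: "a < c" "c < d" "d < b"
  have ind: "integrable (lebesgue_on {a..b}) (\<lambda>s. f s * indicator {c<..<d} s)"
    using f cd by (intro integrable_real_mult_indicator) (auto simp: sets_restrict_space_iff)
  have "(\<lambda>n. LINT s|lebesgue_on {a..b}. f s * bump c d n s) \<longlonglongrightarrow>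
      (LINT s|lebesgue_on {a..b}. f s * indicator {c<..<d} s)"
  proof (rule integral_dominated_convergence[where w = "\<lambda>s. norm (f s)"])
    show "(\<lambda>s. f s * bump c d n s) \<in> borel_measurable (lebesgue_on {a..b})" for n
      using f by (intro borel_measurable_integrable integrable_mult_continuous_on smooth_continuous_on smooth_bump)
  qed (use f ind in \<open>auto intro!: AE_I2 tendsto_mult bump_tendsto mult_left_le
         simp: abs_mult bump_bounds\<close>)
  moreover have "(LINT s|lebesgue_on {a..b}. f s * bump c d n s) = 0" for n
    using cd by (intro 0 bump_in_test_functions)
  ultimately have "0 = (LINT s|lebesgue_on {a..b}. f s * indicator {c<..<d} s)"
    by (simp add: LIMSEQ_const_iff)
  also have "\<dots> = integral {a..b} (\<lambda>s. f s * indicator {c<..<d} s)"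
    by (rule lebesgue_integral_eq_integral[OF ind]) simp
  also have "\<dots> = integral {a..b} (\<lambda>s. if s \<in> {c<..<d} then f s else 0)"
    by (intro Henstock_Kurzweil_Integration.integral_cong) auto
  also have "\<dots> = integral ({c<..<d} \<inter> {a..b}) f"
    by (rule Henstock_Kurzweil_Integration.integral_restrict_Int)
  also have "{c<..<d} \<inter> {a..b} = {c<..<d}" using cd by auto
  also have "integral {c<..<d} f = integral {c..d} f"
    by (simp add: integral_open_interval_real)
  finally show "integral {c..d} f = 0" by simp
qed

text \<open>The primitive from \<open>a\<close> is 0 left of the support by construction. Right of
  the support it is constant, and the vanishing mean of \<open>\<zeta>\<close> says that this
  constant is 0; so the primitive has compact support inside the open interval as well.\<close>

lemma test_function_antiderivative:
  assumes "a < b" and \<zeta>: "\<zeta> \<in> test_functions a b" and 0: "(LINT s|lebesgue_on {a..b}. \<zeta> s) = 0"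
  obtains \<phi> where "\<phi> \<in> test_functions a b" "deriv \<phi> = \<zeta>"
proof -
  obtain c d where cd: "a < c" "d < b" "\<And>s. s \<notin> {c..d} \<Longrightarrow> \<zeta> s = 0" and "smooth \<zeta>"
    using \<zeta> by (auto simp: test_functions_iff)
  have cont: "continuous_on S \<zeta>" for S
    by (rule test_functions_continuous_on[OF \<zeta>])
  define \<phi> where "\<phi> s = integral {a..s} \<zeta>" for s
  have left: "\<phi> s = 0" if "s < c" for s
  proof -
    have "integral {a..s} \<zeta> = integral {a..s} (\<lambda>_. 0)"
      using that cd(3) by (intro Henstock_Kurzweil_Integration.integral_cong) auto
    then show ?thesis by (simp add: \<phi>_def)
  qed
  \<comment> \<open>The split is at \<open>c\<close>, not at \<open>a\<close>: since
    \<open>a < c\<close>, every \<open>s \<ge> c\<close> is interior to \<open>{a..s + 1}\<close>,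
    and the one-sided derivative of the integral becomes two-sided.\<close>
  have deriv: "(\<phi> has_real_derivative \<zeta> s) (at s)" for s
  proof (cases "s < c")
    case True
    have "((\<lambda>_. 0) has_real_derivative \<zeta> s) (at s)" using True cd(3)[of s] by simp
    then show ?thesis
      by (rule has_field_derivative_transform_within_open[where S = "{..<c}"]) (use True left in auto)
  next
    case False
    then have "((\<lambda>s. integral {a..s} \<zeta>) has_real_derivative \<zeta> s) (at s within {a..s + 1})"
      using cd by (intro integral_has_real_derivative cont) auto
    moreover have "at s within {a..s + 1} = at s"
      using False cd by (intro at_within_interior) auto
    ultimately show ?thesis by (simp add: \<phi>_def[abs_def])
  qed
  have "\<phi> b = 0"
    using 0 lebesgue_integral_eq_integral[of "{a..b}" \<zeta>] cont
    by (simp add: \<phi>_def continuous_imp_integrable_real)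
  have right: "\<phi> s = 0" if "d < s" for s
  proof -
    have "\<exists>k. \<forall>s\<in>{d<..}. \<phi> s = k"
    proof (rule has_field_derivative_zero_constant)
      show "(\<phi> has_real_derivative 0) (at s within {d<..})" if "s \<in> {d<..}" for s
        using deriv[of s] cd(3)[of s] that by (simp add: has_field_derivative_at_within)
    qed simp
    then show ?thesis using \<open>\<phi> b = 0\<close> that cd(2) by auto
  qed
  show thesis
  proof
    show "deriv \<phi> = \<zeta>" using deriv by (auto simp: DERIV_imp_deriv)
    show "\<phi> \<in> test_functions a b"
      unfolding test_functions_iff using smooth_antideriv[OF deriv \<open>smooth \<zeta>\<close>] left right cd(1,2)
      by (metis atLeastAtMost_iff not_le)
  qed
qed

text \<open>Subtracting from a test function \<open>\<eta>\<close> the multiple of a fixed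
  \<open>\<psi>\<close> with the same integral leaves mean zero, hence the derivative of a test
  function, which \<open>f\<close> annihilates. So the integral of \<open>f \<eta>\<close> is
  \<open>k\<close> times that of \<open>\<eta>\<close>, where \<open>k\<close> is the quotient of
  the integrals of \<open>f \<psi>\<close> and \<open>\<psi>\<close>. The fundamental lemma applied
  to \<open>f - k\<close> finishes.\<close>

lemma du_Bois_Reymond:
  assumes "a < b" and f: "integrable (lebesgue_on {a..b}) f"
    and 0: "\<And>\<phi>. \<phi> \<in> test_functions a b \<Longrightarrow> (LINT s|lebesgue_on {a..b}. f s * deriv \<phi> s) = 0"
  obtains k where "AE s in lebesgue_on {a..b}. f s = k"
proof -
  let ?M = "lebesgue_on {a..b}"
  \<comment> \<open>The points trisect the interval; the argument only requires
    \<open>a < c < d < b\<close>.\<close>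
  define c d where "c = (2 * a + b) / 3" and "d = (a + 2 * b) / 3"
  have cd: "a < c" "c < d" "d < b" using \<open>a < b\<close> by (auto simp: c_def d_def)
  define \<psi> where "\<psi> = bump c d 1"
  have \<psi>: "\<psi> \<in> test_functions a b"
    unfolding \<psi>_def using cd by (intro bump_in_test_functions)
  have int: "integrable ?M \<phi>" "integrable ?M (\<lambda>s. f s * \<phi> s)" if "\<phi> \<in> test_functions a b" for \<phi>
    using that f by (auto intro: continuous_imp_integrable_real integrable_mult_continuous_on test_functions_continuous_on)
  define I where "I = (LINT s|?M. \<psi> s)"
  \<comment> \<open>A nonnegative function with integral 0 vanishes almost everywhere, but
    \<open>\<psi>\<close> is positive on the nonempty open interval between \<open>c\<close> and
    \<open>d\<close>, which is not negligible.\<close>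
  have "I \<noteq> 0"
  proof
    assume "I = 0"
    then have ae: "AE s in ?M. \<psi> s = 0"
      unfolding I_def using int(1)[OF \<psi>]
      by (subst (asm) integral_nonneg_eq_0_iff_AE) (auto simp: \<psi>_def bump_bounds)
    then have "AE s in lebesgue. s \<in> {a..b} \<longrightarrow> \<psi> s = 0"
      by (subst (asm) AE_restrict_space_iff) auto
    then have "AE s in lebesgue. s \<notin> {c<..<d}"
    proof eventually_elim
      case (elim s)
      show ?case
      proof
        assume "s \<in> {c<..<d}"
        then have "\<psi> s > 0" "s \<in> {a..b}" using cd by (auto simp: \<psi>_def intro!: bump_pos)
        then show False using elim by simp
      qed
    qed
    then have "negligible {c<..<d}"
      unfolding eventually_ae_filter_negligible by (simp del: greaterThanLessThan_iff) (blast intro: negligible_subset)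
    then show False using cd open_not_negligible[of "{c<..<d}"] by auto
  qed
  define k where "k = (LINT s|?M. f s * \<psi> s) / I"
  have "AE s in ?M. f s - k = 0"
  proof (rule fundamental_lemma_calculus_of_variations)
    show "integrable ?M (\<lambda>s. f s - k)" using f by auto
    fix \<eta> assume \<eta>: "\<eta> \<in> test_functions a b"
    define J where "J = (LINT s|?M. \<eta> s)"
    define \<zeta> where "\<zeta> = (\<lambda>s. \<eta> s + (- J / I) * \<psi> s)"
    have \<zeta>: "\<zeta> \<in> test_functions a b"
      unfolding \<zeta>_def by (rule test_functions_add_scaled[OF \<eta> \<psi>])
    have "(LINT s|?M. \<zeta> s) = J + (- J / I) * I"
      unfolding \<zeta>_def I_def J_def using int(1)[OF \<eta>] int(1)[OF \<psi>]
      by (subst Bochner_Integration.integral_add) auto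
    also have "\<dots> = 0" using \<open>I \<noteq> 0\<close> by simp
    finally obtain \<phi> where "\<phi> \<in> test_functions a b" "deriv \<phi> = \<zeta>"
      using test_function_antiderivative[OF \<open>a < b\<close> \<zeta>] by blast
    then have "0 = (LINT s|?M. f s * \<zeta> s)" using 0 by metis
    also have "\<dots> = (LINT s|?M. f s * \<eta> s + (- J / I) * (f s * \<psi> s))"
      by (simp add: \<zeta>_def algebra_simps)
    also have "\<dots> = (LINT s|?M. f s * \<eta> s) + (- J / I) * (LINT s|?M. f s * \<psi> s)"
      using int(2)[OF \<eta>] int(2)[OF \<psi>]
      by (subst Bochner_Integration.integral_add) auto
    also have "\<dots> = (LINT s|?M. f s * \<eta> s) - k * J"
      by (simp add: k_def)
    also have "\<dots> = (LINT s|?M. (f s - k) * \<eta> s)"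
      using int[OF \<eta>] by (simp add: left_diff_distrib J_def)
    finally show "(LINT s|?M. (f s - k) * \<eta> s) = 0" by simp
  qed
  then show thesis by (intro that[of k]) simp
qed

subsection \<open>Square-integrable functions\<close>

text \<open>On a bounded interval constants are integrable, and
  \<open>\<bar>f\<bar> \<le> 1 + f^2\<close> pointwise.\<close>

lemma L2_real_integrable:
  assumes "f \<in> L2_real a b" shows "integrable (lebesgue_on {a..b}) f"
proof (rule Bochner_Integration.integrable_bound)
  show "integrable (lebesgue_on {a..b}) (\<lambda>s. 1 + (f s)\<^sup>2)"
    using assms by (auto simp: L2_real_def)
  have "\<bar>f s\<bar> \<le> 1 + (f s)\<^sup>2" for s
    using sum_squares_bound[of "\<bar>f s\<bar>" 1] by (simp add: power2_abs)
  then show "AE s in lebesgue_on {a..b}. norm (f s) \<le> norm (1 + (f s)\<^sup>2)"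
    by (auto intro!: AE_I2 simp: abs_of_nonneg add_nonneg_nonneg)
qed (use assms in \<open>simp add: L2_real_def\<close>)

lemma L2_real_integrable_mult:
  assumes "f \<in> L2_real a b" "g \<in> L2_real a b"
  shows "integrable (lebesgue_on {a..b}) (\<lambda>s. f s * g s)"
proof (rule Bochner_Integration.integrable_bound)
  show "integrable (lebesgue_on {a..b}) (\<lambda>s. (f s)\<^sup>2 + (g s)\<^sup>2)"
    using assms by (auto simp: L2_real_def)
  have "\<bar>f s * g s\<bar> \<le> (f s)\<^sup>2 + (g s)\<^sup>2" for s
    using sum_squares_bound[of "\<bar>f s\<bar>" "\<bar>g s\<bar>"]
      mult_nonneg_nonneg[OF abs_ge_zero abs_ge_zero, of "f s" "g s"]
    unfolding power2_abs abs_mult by linarith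
  then show "AE s in lebesgue_on {a..b}. norm (f s * g s) \<le> norm ((f s)\<^sup>2 + (g s)\<^sup>2)"
    by (auto intro!: AE_I2 simp: abs_of_nonneg add_nonneg_nonneg)
qed (use assms in \<open>auto simp: L2_real_def\<close>)

lemma L2_real_add:
  assumes "f \<in> L2_real a b" "g \<in> L2_real a b" shows "(\<lambda>s. f s + g s) \<in> L2_real a b"
  using assms L2_real_integrable_mult[OF assms]
  by (auto simp: L2_real_def power2_sum mult.assoc)

lemma L2_real_cmult: "f \<in> L2_real a b \<Longrightarrow> (\<lambda>s. c * f s) \<in> L2_real a b"
  by (auto simp: L2_real_def power_mult_distrib)

lemma L2_real_continuous_on: "continuous_on {a..b} f \<Longrightarrow> f \<in> L2_real a b"
  by (auto simp: L2_real_def intro!: continuous_imp_integrable_real continuous_intros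
      continuous_imp_measurable_on_sets_lebesgue)

lemma L2_real_cong: "(\<And>s. s \<in> {a..b} \<Longrightarrow> f s = g s) \<Longrightarrow> f \<in> L2_real a b \<longleftrightarrow> g \<in> L2_real a b"
  unfolding L2_real_def mem_Collect_eq
  by (intro conj_cong measurable_cong Bochner_Integration.integrable_cong) auto

lemma ae_eq_sym: "ae_eq a b x y \<Longrightarrow> ae_eq a b y x"
  unfolding ae_eq_def by (erule AE_mp) auto

lemma ae_eq_trans: "ae_eq a b x y \<Longrightarrow> ae_eq a b y z \<Longrightarrow> ae_eq a b x z"
  unfolding ae_eq_def by (erule (1) eventually_elim2) auto

lemma ae_eqI: "(\<And>s. s \<in> {a..b} \<Longrightarrow> x s = y s) \<Longrightarrow> ae_eq a b x y"
  unfolding ae_eq_def by (rule AE_I2) simp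

lemma integral_cong_ae_eq:
  assumes "ae_eq a b f g" "f \<in> borel_measurable (lebesgue_on {a..b})"
    "g \<in> borel_measurable (lebesgue_on {a..b})"
  shows "(LINT s|lebesgue_on {a..b}. f s :: real) = (LINT s|lebesgue_on {a..b}. g s)"
  using assms unfolding ae_eq_def by (intro integral_cong_AE)

subsection \<open>Indefinite integrals\<close>

text \<open>Written as a Lebesgue integral over \<open>lebesgue_on {a..s}\<close> so that components
  of \<open>vec_integral\<close>, and hence of \<open>PI_op\<close>, have this form
  literally.\<close>

definition indef :: "real \<Rightarrow> (real \<Rightarrow> real) \<Rightarrow> real \<Rightarrow> real" where
  "indef a f s = (LINT \<theta>|lebesgue_on {a..s}. f \<theta>)"

lemma indef_continuous_on: "f \<in> L2_real a b \<Longrightarrow> continuous_on {a..b} (indef a f)"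
  unfolding indef_def by (intro indefinite_integral_continuous_real L2_real_integrable)

lemma indef_lower: "indef a f a = 0"
proof -
  have "AE t in lebesgue. t \<in> {a} \<longrightarrow> f t = 0"
    unfolding eventually_ae_filter_negligible by (rule exI[of _ "{a}"]) auto
  then have "AE t in lebesgue_on {a}. f t = 0"
    by (subst AE_restrict_space_iff) simp_all
  then show ?thesis
    by (simp add: indef_def integral_eq_zero_AE)
qed

text \<open>Both sides integrate \<open>f \<theta> * g s\<close> over the triangle where
  \<open>a \<le> \<theta> \<le> s \<le> b\<close>. The identity is used twice: with \<open>g\<close>
  the derivative of a test function it is integration by parts, and with \<open>g = 1\<close> it is
  Cauchy's formula.\<close>

lemma Fubini_triangle:
  fixes f g :: "real \<Rightarrow> real"
  assumes f: "integrable (lebesgue_on {a..b}) f" and g: "continuous_on {a..b} g"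
  shows "(LINT s|lebesgue_on {a..b}. indef a f s * g s) =
         (LINT \<theta>|lebesgue_on {a..b}. f \<theta> * (LINT s|lebesgue_on {\<theta>..b}. g s))"
proof -
  let ?M = "lebesgue_on {a..b}"
  let ?h = "\<lambda>\<theta> s. if \<theta> \<le> s then f \<theta> * g s else 0"
  interpret finite_measure ?M
    by (rule finite_measure_lebesgue_on) simp
  interpret pair_sigma_finite ?M ?M ..
  have gi: "integrable ?M g"
    by (rule continuous_imp_integrable_real[OF g])
  have [measurable]: "f \<in> borel_measurable ?M" "g \<in> borel_measurable ?M"
    using f gi by auto
  have [measurable]: "(\<lambda>s. s) \<in> borel_measurable ?M"
    using id_borel_measurable_lebesgue_on by (simp add: id_def)
  \<comment> \<open>Integrability is proved for the product on the whole square, which dominates the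
    version cut off to the triangle.\<close>
  have "integrable (?M \<Otimes>\<^sub>M ?M) (\<lambda>(\<theta>, s). f \<theta> * g s)"
  proof (rule Fubini_integrable)
    show "integrable ?M (\<lambda>\<theta>. LINT s|?M. norm (case (\<theta>, s) of (\<theta>, s) \<Rightarrow> f \<theta> * g s))"
      using f gi by (simp add: abs_mult)
  qed (use gi in auto)
  then have "integrable (?M \<Otimes>\<^sub>M ?M) (case_prod ?h)"
    by (rule Bochner_Integration.integrable_bound) (auto intro!: AE_I2)
  then have swap: "(LINT s|?M. (LINT \<theta>|?M. ?h \<theta> s)) = (LINT \<theta>|?M. (LINT s|?M. ?h \<theta> s))"
    by (rule Fubini_integral)
  have inner: "(LINT \<theta>|?M. ?h \<theta> s) = indef a f s * g s" if "s \<in> {a..b}" for s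
  proof -
    have "(LINT \<theta>|?M. ?h \<theta> s) = (LINT \<theta>|?M. (if \<theta> \<in> {a..s} then f \<theta> * g s else 0))"
      by (intro Bochner_Integration.integral_cong) auto
    also have "\<dots> = (LINT \<theta>|lebesgue_on {a..s}. f \<theta> * g s)"
      using that by (intro Lebesgue_Measure.integral_restrict) auto
    finally show ?thesis by (simp add: indef_def)
  qed
  have outer: "(LINT s|?M. ?h \<theta> s) = f \<theta> * (LINT s|lebesgue_on {\<theta>..b}. g s)" if "\<theta> \<in> {a..b}" for \<theta>
  proof -
    have "(LINT s|?M. ?h \<theta> s) = (LINT s|?M. (if s \<in> {\<theta>..b} then f \<theta> * g s else 0))"
      by (intro Bochner_Integration.integral_cong) auto
    also have "\<dots> = (LINT s|lebesgue_on {\<theta>..b}. f \<theta> * g s)"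
      using that by (intro Lebesgue_Measure.integral_restrict) auto
    finally show ?thesis by simp
  qed
  have "(LINT s|?M. indef a f s * g s) = (LINT s|?M. (LINT \<theta>|?M. ?h \<theta> s))"
    by (rule Bochner_Integration.integral_cong) (simp_all only: inner space_lebesgue_on)
  also note swap
  also have "(LINT \<theta>|?M. (LINT s|?M. ?h \<theta> s)) = (LINT \<theta>|?M. f \<theta> * (LINT s|lebesgue_on {\<theta>..b}. g s))"
    by (rule Bochner_Integration.integral_cong) (simp_all only: outer space_lebesgue_on)
  finally show ?thesis .
qed

text \<open>Cauchy's formula for repeated integration. It is the origin of the weight
  \<open>s - \<theta>\<close> in \<open>G1\<close> and, at \<open>s = b\<close>, of
  \<open>b - \<theta>\<close> in \<open>Q_mat\<close>.\<close>

lemma indef_indef: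
  assumes "integrable (lebesgue_on {a..s}) f"
  shows "indef a (indef a f) s = (LINT \<theta>|lebesgue_on {a..s}. (s - \<theta>) * f \<theta>)"
proof -
  have "indef a (indef a f) s = (LINT \<theta>|lebesgue_on {a..s}. f \<theta> * (LINT t|lebesgue_on {\<theta>..s}. 1))"
    using Fubini_triangle[OF assms, of "\<lambda>_. 1"] by (simp add: indef_def)
  also have "\<dots> = (LINT \<theta>|lebesgue_on {a..s}. (s - \<theta>) * f \<theta>)"
    by (intro Bochner_Integration.integral_cong)
      (auto simp: measure_restrict_space mult.commute)
  finally show ?thesis .
qed

lemma indef_add:
  assumes "f \<in> L2_real a b" "g \<in> L2_real a b" "s \<le> b"
  shows "indef a (\<lambda>t. f t + g t) s = indef a f s + indef a g s"
  unfolding indef_def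
  by (rule Bochner_Integration.integral_add)
    (use assms in \<open>auto intro!: integrable_subinterval[OF L2_real_integrable]\<close>)

lemma indef_cmult: "indef a (\<lambda>t. c * f t) s = c * indef a f s"
  by (simp add: indef_def)

lemma indef_cong: "(\<And>t. t \<in> {a..s} \<Longrightarrow> f t = g t) \<Longrightarrow> indef a f s = indef a g s"
  unfolding indef_def by (intro Bochner_Integration.integral_cong) auto

lemma indef_cong_ae_eq:
  assumes "ae_eq a b f g" "f \<in> L2_real a b" "g \<in> L2_real a b" "s \<le> b"
  shows "indef a f s = indef a g s"
  unfolding indef_def
proof (rule integral_cong_AE)
  have "AE t in lebesgue. t \<in> {a..b} \<longrightarrow> f t = g t"
    using assms(1) unfolding ae_eq_def by (subst (asm) AE_restrict_space_iff) auto
  then show "AE t in lebesgue_on {a..s}. f t = g t"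
    using \<open>s \<le> b\<close> by (subst AE_restrict_space_iff) (auto elim!: eventually_mono)
qed (use assms in \<open>auto intro!: borel_measurable_integrable integrable_subinterval[OF L2_real_integrable]\<close>)

lemma L2_real_indef: "f \<in> L2_real a b \<Longrightarrow> indef a f \<in> L2_real a b"
  by (rule L2_real_continuous_on[OF indef_continuous_on])

subsection \<open>Weak derivatives\<close>

lemma test_functions_higher_deriv: "\<phi> \<in> test_functions a b \<Longrightarrow> (deriv ^^ k) \<phi> \<in> test_functions a b"
  by (induction k) (auto intro: test_functions_deriv)

lemma test_functions_L2: "\<phi> \<in> test_functions a b \<Longrightarrow> \<phi> \<in> L2_real a b"
  by (intro L2_real_continuous_on test_functions_continuous_on)

lemma integral_deriv_test_function:
  assumes "\<phi> \<in> test_functions a b" "s \<le> b"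
  shows "(LINT t|lebesgue_on {s..b}. deriv \<phi> t) = - \<phi> s"
proof -
  have "integrable (lebesgue_on {s..b}) (deriv \<phi>)"
    by (intro continuous_imp_integrable_real test_functions_continuous_on[OF test_functions_deriv[OF assms(1)]])
  then have "(LINT t|lebesgue_on {s..b}. deriv \<phi> t) = integral {s..b} (deriv \<phi>)"
    by (rule lebesgue_integral_eq_integral) simp
  also have "(deriv \<phi> has_integral (\<phi> b - \<phi> s)) {s..b}"
    using assms
    by (intro fundamental_theorem_of_calculus)
      (auto simp flip: has_real_derivative_iff_has_vector_derivative
        intro: has_field_derivative_at_within test_functions_has_deriv)
  then have "integral {s..b} (deriv \<phi>) = \<phi> b - \<phi> s"
    by (rule integral_unique)
  finally show ?thesis
    using test_functions_endpoints[OF assms(1)] by simp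
qed

lemma has_weak_deriv_cong_ae_eq:
  assumes "ae_eq a b f f'" "f \<in> L2_real a b" "f' \<in> L2_real a b" "has_weak_deriv a b k f g"
  shows "has_weak_deriv a b k f' g"
proof -
  have "(LINT s|lebesgue_on {a..b}. f s * (deriv ^^ k) \<phi> s) = (LINT s|lebesgue_on {a..b}. f' s * (deriv ^^ k) \<phi> s)"
    if "\<phi> \<in> test_functions a b" for \<phi>
    by (rule integral_cong_AE)
      (use assms(1-3) that in \<open>auto simp: ae_eq_def intro!: borel_measurable_integrable L2_real_integrable_mult
          test_functions_L2 test_functions_higher_deriv\<close>)
  then show ?thesis using assms(4) by (simp add: has_weak_deriv_def)
qed

lemma has_weak_deriv_0: "has_weak_deriv a b 0 f f"
  by (simp add: has_weak_deriv_def)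

text \<open>Exchanging integrals leaves \<open>f s\<close> times the integral of
  \<open>deriv \<phi>\<close> over \<open>{s..b}\<close>, which is \<open>- \<phi> s\<close> because
  \<open>\<phi>\<close> vanishes at \<open>b\<close>. The constant contributes \<open>c\<close>
  times \<open>\<phi> b - \<phi> a\<close>, which is 0.\<close>

lemma has_weak_deriv_indef:
  assumes "a < b" and f: "f \<in> L2_real a b"
  shows "has_weak_deriv a b 1 (\<lambda>s. c + indef a f s) f"
  unfolding has_weak_deriv_def
proof
  fix \<phi> assume \<phi>: "\<phi> \<in> test_functions a b"
  let ?M = "lebesgue_on {a..b}"
  have \<phi>': "deriv \<phi> \<in> L2_real a b" "continuous_on {a..b} (deriv \<phi>)"
    using \<phi> by (auto intro: test_functions_L2 test_functions_deriv test_functions_continuous_on)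
  have "(LINT s|?M. (c + indef a f s) * deriv \<phi> s) = (LINT s|?M. c * deriv \<phi> s) + (LINT s|?M. indef a f s * deriv \<phi> s)"
    unfolding distrib_right using \<phi>'(1) f
    by (intro Bochner_Integration.integral_add integrable_mult_right L2_real_integrable L2_real_integrable_mult L2_real_indef)
  also have "(LINT s|?M. c * deriv \<phi> s) = 0"
    using integral_deriv_test_function[OF \<phi>, of a] \<open>a < b\<close> test_functions_endpoints[OF \<phi>] by simp
  also have "(LINT s|?M. indef a f s * deriv \<phi> s) = (LINT s|?M. f s * (LINT t|lebesgue_on {s..b}. deriv \<phi> t))"
    by (intro Fubini_triangle L2_real_integrable f \<phi>')
  also have "\<dots> = (LINT s|?M. - (f s * \<phi> s))"
    by (intro Bochner_Integration.integral_cong) (auto simp: integral_deriv_test_function[OF \<phi>])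
  finally show "(LINT s|?M. (c + indef a f s) * (deriv ^^ 1) \<phi> s) = (- 1) ^ 1 * (LINT s|?M. f s * \<phi> s)"
    by simp
qed

lemma has_weak_deriv_2:
  assumes "has_weak_deriv a b 1 f g" "has_weak_deriv a b 1 g h"
  shows "has_weak_deriv a b 2 f h"
  unfolding has_weak_deriv_def
proof
  fix \<phi> assume \<phi>: "\<phi> \<in> test_functions a b"
  show "(LINT s|lebesgue_on {a..b}. f s * (deriv ^^ 2) \<phi> s) = (- 1) ^ 2 * (LINT s|lebesgue_on {a..b}. h s * \<phi> s)"
    using assms(1)[unfolded has_weak_deriv_def, rule_format, OF test_functions_deriv[OF \<phi>]]
      assms(2)[unfolded has_weak_deriv_def, rule_format, OF \<phi>]
    by (simp add: numeral_2_eq_2)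
qed

text \<open>In \<open>sobolev_real\<close> the weak derivatives of the different orders are supplied
  independently of each other; this ties them together. Testing the first assumption with
  \<open>deriv \<phi>\<close>, again a test function, makes both assumptions speak of the same
  integral.\<close>

lemma has_weak_deriv_1_of_2:
  assumes "has_weak_deriv a b 1 f g" "has_weak_deriv a b 2 f h"
  shows "has_weak_deriv a b 1 g h"
  unfolding has_weak_deriv_def
proof
  fix \<phi> assume \<phi>: "\<phi> \<in> test_functions a b"
  show "(LINT s|lebesgue_on {a..b}. g s * (deriv ^^ 1) \<phi> s) = (- 1) ^ 1 * (LINT s|lebesgue_on {a..b}. h s * \<phi> s)"
    using assms(1)[unfolded has_weak_deriv_def, rule_format, OF test_functions_deriv[OF \<phi>]]
      assms(2)[unfolded has_weak_deriv_def, rule_format, OF \<phi>]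
    by (simp add: numeral_2_eq_2)
qed

lemma has_weak_deriv_unique:
  assumes "has_weak_deriv a b k f g" "has_weak_deriv a b k f h" "g \<in> L2_real a b" "h \<in> L2_real a b"
  shows "ae_eq a b g h"
proof -
  have "AE s in lebesgue_on {a..b}. g s - h s = 0"
  proof (rule fundamental_lemma_calculus_of_variations)
    show "integrable (lebesgue_on {a..b}) (\<lambda>s. g s - h s)"
      using assms by (intro Bochner_Integration.integrable_diff L2_real_integrable)
    fix \<phi> assume \<phi>: "\<phi> \<in> test_functions a b"
    have "(- 1) ^ k * (LINT s|lebesgue_on {a..b}. g s * \<phi> s) = (- 1) ^ k * (LINT s|lebesgue_on {a..b}. h s * \<phi> s)"
      using assms(1,2) \<phi> by (simp add: has_weak_deriv_def)
    then have "(LINT s|lebesgue_on {a..b}. g s * \<phi> s) = (LINT s|lebesgue_on {a..b}. h s * \<phi> s)"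
      by simp
    then show "(LINT s|lebesgue_on {a..b}. (g s - h s) * \<phi> s) = 0"
      unfolding left_diff_distrib using assms \<phi>
      by (subst Bochner_Integration.integral_diff) (auto intro: L2_real_integrable_mult test_functions_L2)
  qed
  then show ?thesis by (simp add: ae_eq_def)
qed

text \<open>The difference of \<open>f\<close> and the indefinite integral of \<open>g\<close> has
  weak derivative 0, so it is constant by du Bois-Reymond.\<close>

lemma has_weak_deriv_imp_indef:
  assumes "a < b" "has_weak_deriv a b 1 f g" "f \<in> L2_real a b" "g \<in> L2_real a b"
  obtains c where "ae_eq a b f (\<lambda>s. c + indef a g s)"
proof -
  let ?h = "\<lambda>s. f s + (-1) * indef a g s"
  have h: "?h \<in> L2_real a b"
    using assms by (intro L2_real_add L2_real_cmult L2_real_indef)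
  have "(LINT s|lebesgue_on {a..b}. ?h s * deriv \<phi> s) = 0" if \<phi>: "\<phi> \<in> test_functions a b" for \<phi>
  proof -
    have \<phi>': "deriv \<phi> \<in> L2_real a b" using \<phi> by (intro test_functions_L2 test_functions_deriv)
    have "(LINT s|lebesgue_on {a..b}. ?h s * deriv \<phi> s) =
        (LINT s|lebesgue_on {a..b}. f s * deriv \<phi> s) - (LINT s|lebesgue_on {a..b}. indef a g s * deriv \<phi> s)"
      using assms \<phi>'
      by (subst Bochner_Integration.integral_diff[symmetric])
        (auto intro: L2_real_integrable_mult L2_real_indef simp: algebra_simps)
    then show ?thesis
      using assms(2) has_weak_deriv_indef[OF assms(1,4), of 0] \<phi> by (auto simp: has_weak_deriv_def)
  qed
  then obtain c where c: "AE s in lebesgue_on {a..b}. ?h s = c"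
    by (rule du_Bois_Reymond[OF assms(1) L2_real_integrable[OF h]])
  then have "ae_eq a b f (\<lambda>s. c + indef a g s)"
    unfolding ae_eq_def by eventually_elim auto
  then show thesis by (rule that)
qed

text \<open>The points of the open interval where the functions differ form a set that is both open
  and negligible, hence empty. The end points follow by continuity.\<close>

lemma continuous_ae_eq_imp_eq:
  fixes f g :: "real \<Rightarrow> real"
  assumes "a < b" and cont: "continuous_on {a..b} f" "continuous_on {a..b} g"
    and "ae_eq a b f g" "s \<in> {a..b}"
  shows "f s = g s"
proof -
  let ?U = "{s \<in> {a<..<b}. f s - g s \<in> - {0}}"
  have "AE s in lebesgue. s \<in> {a..b} \<longrightarrow> f s = g s"
    using \<open>ae_eq a b f g\<close> unfolding ae_eq_def by (subst (asm) AE_restrict_space_iff) auto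
  then obtain N where "negligible N" "{s. \<not> (s \<in> {a..b} \<longrightarrow> f s = g s)} \<subseteq> N"
    unfolding eventually_ae_filter_negligible by blast
  then have neg: "negligible ?U"
    by (rule_tac negligible_subset[of N]) auto
  have d: "continuous_on {a..b} (\<lambda>s. f s - g s)"
    by (intro continuous_on_diff cont)
  then have "continuous_on {a<..<b} (\<lambda>s. f s - g s)"
    by (rule continuous_on_subset) auto
  then have "open ({a<..<b} \<inter> (\<lambda>s. f s - g s) -` (- {0}))"
    by (intro continuous_open_preimage) auto
  then have "open ?U" by (simp add: vimage_def Int_def)
  then have "?U = {}" using neg open_not_negligible by blast
  then have "f s - g s = 0" if "s \<in> {a<..<b}" for s using that by auto
  then have "f s - g s = 0"
    using d \<open>a < b\<close> \<open>s \<in> {a..b}\<close>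
    by (rule_tac continuous_constant_on_closure[of "{a<..<b}" "\<lambda>s. f s - g s"]) auto
  then show ?thesis by simp
qed

text \<open>This eliminates the \<open>SOME\<close> in point values: any continuous representative
  at hand computes them.\<close>

lemma cont_version_real_eq:
  assumes "a < b" "continuous_on {a..b} g" "ae_eq a b f g" "s \<in> {a..b}"
  shows "cont_version_real a b f s = g s"
proof -
  have "continuous_on {a..b} (cont_version_real a b f) \<and> ae_eq a b (cont_version_real a b f) f"
    unfolding cont_version_real_def by (rule someI[of _ g]) (use assms ae_eq_sym in blast)
  then show ?thesis
    using assms by (blast intro: continuous_ae_eq_imp_eq ae_eq_trans)
qed

lemma weak_deriv_real_props:
  assumes "g \<in> L2_real a b" "has_weak_deriv a b k f g"
  shows "weak_deriv_real a b k f \<in> L2_real a b" "has_weak_deriv a b k f (weak_deriv_real a b k f)"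
    "ae_eq a b (weak_deriv_real a b k f) g"
proof -
  have "weak_deriv_real a b k f \<in> L2_real a b \<and> has_weak_deriv a b k f (weak_deriv_real a b k f)"
    unfolding weak_deriv_real_def by (rule someI[of _ g]) (use assms in blast)
  then show "weak_deriv_real a b k f \<in> L2_real a b" "has_weak_deriv a b k f (weak_deriv_real a b k f)"
    by auto
  then show "ae_eq a b (weak_deriv_real a b k f) g"
    using assms by (blast intro: has_weak_deriv_unique)
qed

subsection \<open>Block matrices and vector integrals\<close>

lemma append_rows_mult_mat_vec:
  "dim_col A = dim_vec v \<Longrightarrow> dim_col B = dim_vec v \<Longrightarrow>
    (A @\<^sub>r B) *\<^sub>v v = A *\<^sub>v v @\<^sub>v B *\<^sub>v (v :: real Matrix.vec)"
  by (rule mat_mult_append) auto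

lemma dim_append_rows: "dim_row (A @\<^sub>r B) = dim_row A + dim_row B" "dim_col (A @\<^sub>r B) = dim_col A"
  by (simp_all add: append_rows_def)

lemma dim_append_cols: "dim_row (A @\<^sub>c B) = dim_row A" "dim_col (A @\<^sub>c B) = dim_col A + dim_col B"
  by (simp_all add: append_cols_def)

lemma append_cols_mult_mat_vec:
  assumes "dim_row A = dim_row B" "dim_col A = dim_vec u" "dim_col B = dim_vec v"
  shows "(A @\<^sub>c B) *\<^sub>v (u @\<^sub>v v) = A *\<^sub>v u + B *\<^sub>v v"
proof -
  have "(A @\<^sub>c B) *\<^sub>v (u @\<^sub>v v) =
      (A *\<^sub>v u + B *\<^sub>v v) @\<^sub>v (0\<^sub>m 0 (dim_col A) *\<^sub>v u + 0\<^sub>m 0 (dim_col B) *\<^sub>v v)"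
    unfolding append_cols_def using assms
    by (intro four_block_mat_mult_vec[where ?nr1.0 = "dim_row A"]) auto
  then show ?thesis by (intro eq_vecI) auto
qed

lemma zero_mult_mat_vec: "dim_vec v = m \<Longrightarrow> 0\<^sub>m n m *\<^sub>v v = (0\<^sub>v n :: real Matrix.vec)"
  by (intro eq_vecI) auto

lemma smult_one_mult_mat_vec: "dim_vec v = m \<Longrightarrow> (c \<cdot>\<^sub>m 1\<^sub>m m) *\<^sub>v v = (c \<cdot>\<^sub>v v :: real Matrix.vec)"
  by (intro eq_vecI) (auto simp: scalar_prod_smult_left)

lemma one_mult_mat_vec_dim: "dim_vec v = m \<Longrightarrow> 1\<^sub>m m *\<^sub>v v = (v :: real Matrix.vec)"
  by auto

lemma zero_add_vec_dim:
  "dim_vec v = m \<Longrightarrow> 0\<^sub>v m + v = (v :: real Matrix.vec)"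
  "dim_vec v = m \<Longrightarrow> v + 0\<^sub>v m = (v :: real Matrix.vec)"
  by auto

lemma append_vec_add_dim:
  "dim_vec u = dim_vec u' \<Longrightarrow> dim_vec v = dim_vec v' \<Longrightarrow>
    (u @\<^sub>v v) + (u' @\<^sub>v v') = (u + u') @\<^sub>v (v + (v' :: real Matrix.vec))"
  by (intro eq_vecI) auto

text \<open>All side conditions are equations between dimensions rather than carrier memberships, so
  the simplifier can discharge them while it evaluates nested block matrices, including the case of
  dimension 0.\<close>

lemmas block_mult_simps =
  append_rows_mult_mat_vec append_cols_mult_mat_vec dim_append_rows dim_append_cols
  zero_mult_mat_vec smult_one_mult_mat_vec one_mult_mat_vec_dim zero_add_vec_dim append_vec_add_dim

lemma T_mat_mult:
  assumes "dim_vec c = n1" "dim_vec d = n2" "dim_vec e = n2"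
  shows "T_mat a b n1 n2 *\<^sub>v (c @\<^sub>v d @\<^sub>v e) =
    c @\<^sub>v c @\<^sub>v d @\<^sub>v (d + (b - a) \<cdot>\<^sub>v e) @\<^sub>v e @\<^sub>v e"
  using assms by (simp add: T_mat_def block_mult_simps)

lemma Q_mat_mult:
  assumes "dim_vec x0 = n0" "dim_vec x1 = n1" "dim_vec x2 = n2"
  shows "Q_mat b n0 n1 n2 s \<theta> *\<^sub>v (x0 @\<^sub>v x1 @\<^sub>v x2) =
    0\<^sub>v n1 @\<^sub>v x1 @\<^sub>v 0\<^sub>v n2 @\<^sub>v ((b - \<theta>) \<cdot>\<^sub>v x2) @\<^sub>v 0\<^sub>v n2 @\<^sub>v x2"
  using assms by (simp add: Q_mat_def block_mult_simps)

lemma K_mat_mult: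
  assumes "dim_vec c = n1" "dim_vec d = n2" "dim_vec e = n2"
  shows "K_mat a n0 n1 n2 s *\<^sub>v (c @\<^sub>v d @\<^sub>v e) = 0\<^sub>v n0 @\<^sub>v c @\<^sub>v (d + (s - a) \<cdot>\<^sub>v e)"
  using assms by (simp add: K_mat_def block_mult_simps)

lemma G0_mult:
  assumes "dim_vec x0 = n0" "dim_vec x1 = n1" "dim_vec x2 = n2"
  shows "G0 n0 n1 n2 s *\<^sub>v (x0 @\<^sub>v x1 @\<^sub>v x2) = x0 @\<^sub>v 0\<^sub>v n1 @\<^sub>v 0\<^sub>v n2"
  using assms by (simp add: G0_def block_mult_simps)

text \<open>The summand of \<open>G\<^sub>1\<close> other than \<open>G\<^sub>2\<close>.\<close>

definition L_mat :: "nat \<Rightarrow> nat \<Rightarrow> nat \<Rightarrow> real \<Rightarrow> real \<Rightarrow> real mat" where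
  "L_mat n0 n1 n2 s \<theta> =
       (0\<^sub>m n0 n0 @\<^sub>c 0\<^sub>m n0 n1 @\<^sub>c 0\<^sub>m n0 n2)
    @\<^sub>r (0\<^sub>m n1 n0 @\<^sub>c 1\<^sub>m n1    @\<^sub>c 0\<^sub>m n1 n2)
    @\<^sub>r (0\<^sub>m n2 n0 @\<^sub>c 0\<^sub>m n2 n1 @\<^sub>c (s - \<theta>) \<cdot>\<^sub>m 1\<^sub>m n2)"

lemma L_mat_mult:
  assumes "dim_vec x0 = n0" "dim_vec x1 = n1" "dim_vec x2 = n2"
  shows "L_mat n0 n1 n2 s \<theta> *\<^sub>v (x0 @\<^sub>v x1 @\<^sub>v x2) = 0\<^sub>v n0 @\<^sub>v x1 @\<^sub>v (s - \<theta>) \<cdot>\<^sub>v x2"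
  using assms by (simp add: L_mat_def block_mult_simps)

lemma block_mats_carrier:
  "T_mat a b n1 n2 \<in> carrier_mat (2 * n1 + 4 * n2) (n1 + 2 * n2)"
  "Q_mat b n0 n1 n2 s \<theta> \<in> carrier_mat (2 * n1 + 4 * n2) (n0 + n1 + n2)"
  "K_mat a n0 n1 n2 s \<in> carrier_mat (n0 + n1 + n2) (n1 + 2 * n2)"
  "L_mat n0 n1 n2 s \<theta> \<in> carrier_mat (n0 + n1 + n2) (n0 + n1 + n2)"
  "G0 n0 n1 n2 s \<in> carrier_mat (n0 + n1 + n2) (n0 + n1 + n2)"
  by (auto simp: T_mat_def Q_mat_def K_mat_def L_mat_def G0_def dim_append_rows dim_append_cols)

lemma block_append:
  "x s \<in> carrier_vec (n0 + n1 + n2) \<Longrightarrow>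
    x s = block 0 n0 x s @\<^sub>v block n0 n1 x s @\<^sub>v block (n0 + n1) n2 x s"
  by (intro eq_vecI) (auto simp: block_def algebra_simps)

lemma dim_block: "dim_vec (block k m x s) = m"
  by (simp add: block_def)

lemma vec_three_blocks:
  "v \<in> carrier_vec (m + 2 * n) \<Longrightarrow>
    v = Matrix.vec m (($) v) @\<^sub>v Matrix.vec n (\<lambda>i. v $ (m + i)) @\<^sub>v Matrix.vec n (\<lambda>i. v $ (m + n + i))"
  by (intro eq_vecI) (auto simp: algebra_simps)

lemma coord_block: "i < m \<Longrightarrow> coord i (block k m x) = coord (k + i) x"
  by (simp add: coord_def block_def)

text \<open>Connects the predicate \<open>invertible_mat\<close> with the result of Gauss-Jordan
  elimination: an invertible matrix is a unit of the matrix ring, which rules out the answer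
  \<open>None\<close>.\<close>

lemma the_mat_inverse:
  fixes A :: "real mat"
  assumes A: "A \<in> carrier_mat n n" and "invertible_mat A"
  shows "the (mat_inverse A) \<in> carrier_mat n n"
    "A * the (mat_inverse A) = 1\<^sub>m n" "the (mat_inverse A) * A = 1\<^sub>m n"
proof -
  obtain C where C: "inverts_mat A C" "inverts_mat C A"
    using \<open>invertible_mat A\<close> by (auto simp: invertible_mat_def)
  then have "C \<in> carrier_mat n n" "A * C = 1\<^sub>m n" "C * A = 1\<^sub>m n"
    using A unfolding inverts_mat_def
    by (metis carrier_matD carrier_matI index_mult_mat(2,3) index_one_mat(2,3))+
  then have "A \<in> Units (ring_mat TYPE(real) n ())"
    using A by (auto simp: Units_def ring_mat_simps)
  then obtain D where "mat_inverse A = Some D"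
    using mat_inverse(1)[OF A] by fastforce
  then show "the (mat_inverse A) \<in> carrier_mat n n"
    "A * the (mat_inverse A) = 1\<^sub>m n" "the (mat_inverse A) * A = 1\<^sub>m n"
    using mat_inverse(2)[OF A] by auto
qed

section \<open>Componentwise integration of vector-valued functions\<close>

lemma vec_integral_carrier: "vec_integral m S h \<in> carrier_vec m"
  by (simp add: vec_integral_def)

lemma vec_integral_cong:
  "(\<And>\<theta>. \<theta> \<in> S \<Longrightarrow> f \<theta> = g \<theta>) \<Longrightarrow> vec_integral m S f = vec_integral m S g"
  unfolding vec_integral_def
  by (intro eq_vecI) (auto intro!: Bochner_Integration.integral_cong)

lemma vec_integral_append:
  assumes "\<And>\<theta>. \<theta> \<in> S \<Longrightarrow> dim_vec (f \<theta>) = m" "\<And>\<theta>. \<theta> \<in> S \<Longrightarrow> dim_vec (g \<theta>) = k"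
  shows "vec_integral (m + k) S (\<lambda>\<theta>. f \<theta> @\<^sub>v g \<theta>) = vec_integral m S f @\<^sub>v vec_integral k S g"
  unfolding vec_integral_def
  by (intro eq_vecI) (auto intro!: Bochner_Integration.integral_cong simp: assms)

lemma vec_integral_zero: "vec_integral m S (\<lambda>_. 0\<^sub>v m) = 0\<^sub>v m"
  unfolding vec_integral_def by (intro eq_vecI) auto

lemma vec_integral_add:
  assumes "\<And>\<theta>. \<theta> \<in> S \<Longrightarrow> dim_vec (f \<theta>) = m" "\<And>\<theta>. \<theta> \<in> S \<Longrightarrow> dim_vec (g \<theta>) = m"
    and "\<And>i. i < m \<Longrightarrow> integrable (lebesgue_on S) (\<lambda>\<theta>. f \<theta> $ i)"
    and "\<And>i. i < m \<Longrightarrow> integrable (lebesgue_on S) (\<lambda>\<theta>. g \<theta> $ i)"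
  shows "vec_integral m S (\<lambda>\<theta>. f \<theta> + g \<theta>) = vec_integral m S f + vec_integral m S g"
proof (rule eq_vecI)
  fix i assume "i < dim_vec (vec_integral m S f + vec_integral m S g)"
  then have i: "i < m" by (simp add: vec_integral_def)
  have "(LINT \<theta>|lebesgue_on S. (f \<theta> + g \<theta>) $ i) = (LINT \<theta>|lebesgue_on S. f \<theta> $ i + g \<theta> $ i)"
    by (rule Bochner_Integration.integral_cong) (use i assms in auto)
  then show "vec_integral m S (\<lambda>\<theta>. f \<theta> + g \<theta>) $ i = (vec_integral m S f + vec_integral m S g) $ i"
    using i assms by (simp add: vec_integral_def)
qed (simp add: vec_integral_def)

lemma mult_mat_vec_index_sum:
  "A \<in> carrier_mat m k \<Longrightarrow> dim_vec v = k \<Longrightarrow> i < m \<Longrightarrow> (A *\<^sub>v v) $ i = (\<Sum>j<k. A $$ (i, j) * v $ j)"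
  by (auto simp: scalar_prod_def lessThan_atLeast0 intro!: sum.cong)

lemma integrable_mult_mat_vec:
  assumes "A \<in> carrier_mat m k" "i < m"
    and "\<And>\<theta>. \<theta> \<in> S \<Longrightarrow> dim_vec (h \<theta>) = k"
    and "\<And>j. j < k \<Longrightarrow> integrable (lebesgue_on S) (\<lambda>\<theta>. h \<theta> $ j)"
  shows "integrable (lebesgue_on S) (\<lambda>\<theta>. (A *\<^sub>v h \<theta>) $ i :: real)"
proof -
  have "integrable (lebesgue_on S) (\<lambda>\<theta>. \<Sum>j<k. A $$ (i, j) * h \<theta> $ j)"
    using assms by auto
  then show ?thesis
    using assms by (subst Bochner_Integration.integrable_cong[OF refl]) (auto simp: mult_mat_vec_index_sum[OF assms(1)] simp del: index_mult_mat_vec)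
qed

text \<open>Each row of \<open>A\<close> gives a finite linear combination of the components of
  \<open>h\<close>. This is what moves the factor of \<open>G2\<close> that is constant in
  \<open>\<theta>\<close> out of the integral.\<close>

lemma vec_integral_mult_mat_vec:
  assumes "A \<in> carrier_mat m k"
    and "\<And>\<theta>. \<theta> \<in> S \<Longrightarrow> dim_vec (h \<theta>) = k"
    and "\<And>j. j < k \<Longrightarrow> integrable (lebesgue_on S) (\<lambda>\<theta>. h \<theta> $ j)"
  shows "vec_integral m S (\<lambda>\<theta>. A *\<^sub>v h \<theta>) = A *\<^sub>v vec_integral k S h"
proof (rule eq_vecI)
  fix i assume "i < dim_vec (A *\<^sub>v vec_integral k S h)"
  then have i: "i < m" using assms(1) by simp
  have "(LINT \<theta>|lebesgue_on S. (A *\<^sub>v h \<theta>) $ i) = (LINT \<theta>|lebesgue_on S. (\<Sum>j<k. A $$ (i, j) * h \<theta> $ j))"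
    using i assms by (intro Bochner_Integration.integral_cong) (auto simp: mult_mat_vec_index_sum[OF assms(1)] simp del: index_mult_mat_vec)
  also have "\<dots> = (\<Sum>j<k. A $$ (i, j) * (LINT \<theta>|lebesgue_on S. h \<theta> $ j))"
    using assms by simp
  also have "\<dots> = (A *\<^sub>v vec_integral k S h) $ i"
    using i assms(1) by (subst mult_mat_vec_index_sum[OF assms(1)]) (auto simp: vec_integral_def)
  finally show "vec_integral m S (\<lambda>\<theta>. A *\<^sub>v h \<theta>) $ i = (A *\<^sub>v vec_integral k S h) $ i"
    using i by (simp add: vec_integral_def)
qed (use assms in \<open>simp add: vec_integral_def\<close>)

lemma integral_combine_lebesgue_on:
  fixes f :: "real \<Rightarrow> real"
  assumes "integrable (lebesgue_on {a..b}) f" "s \<in> {a..b}"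
  shows "(LINT \<theta>|lebesgue_on {a..s}. f \<theta>) + (LINT \<theta>|lebesgue_on {s..b}. f \<theta>) = (LINT \<theta>|lebesgue_on {a..b}. f \<theta>)"
proof -
  have "integrable (lebesgue_on {a..s}) f" "integrable (lebesgue_on {s..b}) f"
    using assms by (auto intro!: integrable_subinterval[OF assms(1)])
  then show ?thesis
    using assms by (simp add: lebesgue_integral_eq_integral Henstock_Kurzweil_Integration.integral_combine integrable_on_lebesgue_on)
qed

lemma vec_integral_combine:
  assumes "\<And>i. i < m \<Longrightarrow> integrable (lebesgue_on {a..b}) (\<lambda>\<theta>. h \<theta> $ i)" "s \<in> {a..b}"
  shows "vec_integral m {a..s} h + vec_integral m {s..b} h = vec_integral m {a..b} h"
  unfolding vec_integral_def
  by (intro eq_vecI) (use assms in \<open>simp_all add: integral_combine_lebesgue_on\<close>)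

lemma vec_integral_smult:
  assumes "\<And>\<theta>. dim_vec (f \<theta>) = m"
  shows "vec_integral m S (\<lambda>\<theta>. c \<cdot>\<^sub>v f \<theta>) = c \<cdot>\<^sub>v vec_integral m S f"
  unfolding vec_integral_def by (intro eq_vecI) (simp_all add: assms)

lemma integrable_append_vec:
  assumes "\<And>\<theta>. \<theta> \<in> S \<Longrightarrow> dim_vec (f \<theta>) = m" "\<And>\<theta>. \<theta> \<in> S \<Longrightarrow> dim_vec (g \<theta>) = k"
    and "\<And>i. i < m \<Longrightarrow> integrable (lebesgue_on S) (\<lambda>\<theta>. f \<theta> $ i :: real)"
    and "\<And>i. i < k \<Longrightarrow> integrable (lebesgue_on S) (\<lambda>\<theta>. g \<theta> $ i)"
    and "i < m + k"
  shows "integrable (lebesgue_on S) (\<lambda>\<theta>. (f \<theta> @\<^sub>v g \<theta>) $ i)"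
proof -
  have "integrable (lebesgue_on S) (\<lambda>\<theta>. if i < m then f \<theta> $ i else g \<theta> $ (i - m))"
    using assms(3)[of i] assms(4)[of "i - m"] assms(5) by (cases "i < m") auto
  then show ?thesis
    by (subst Bochner_Integration.integrable_cong[OF refl]) (use assms in auto)
qed

lemma vec_integral_block:
  "vec_integral m {a..s} (block k m x) = Matrix.vec m (\<lambda>i. indef a (coord (k + i) x) s)"
  by (intro eq_vecI) (auto simp: vec_integral_def block_def indef_def coord_def)

lemma L2_coord: "x \<in> L2 a b m \<Longrightarrow> i < m \<Longrightarrow> coord i x \<in> L2_real a b"
  by (simp add: L2_def)

lemma L2_coord_integrable:
  "x \<in> L2 a b m \<Longrightarrow> i < m \<Longrightarrow> s \<le> b \<Longrightarrow> integrable (lebesgue_on {a..s}) (coord i x)"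
  by (rule integrable_subinterval[OF L2_real_integrable[OF L2_coord]]) auto

lemma vec_integral_smult_block:
  assumes "x \<in> L2 a b n" "k + m \<le> n" "s \<le> b"
  shows "vec_integral m {a..s} (\<lambda>\<theta>. (s - \<theta>) \<cdot>\<^sub>v block k m x \<theta>) =
    Matrix.vec m (\<lambda>i. indef a (indef a (coord (k + i) x)) s)"
proof (rule eq_vecI)
  fix i assume i: "i < dim_vec (Matrix.vec m (\<lambda>i. indef a (indef a (coord (k + i) x)) s))"
  then have "indef a (indef a (coord (k + i) x)) s =
      (LINT \<theta>|lebesgue_on {a..s}. (s - \<theta>) * coord (k + i) x \<theta>)"
    using assms by (intro indef_indef L2_coord_integrable) auto
  then show "vec_integral m {a..s} (\<lambda>\<theta>. (s - \<theta>) \<cdot>\<^sub>v block k m x \<theta>) $ i =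
      Matrix.vec m (\<lambda>i. indef a (indef a (coord (k + i) x)) s) $ i"
    using i by (simp add: vec_integral_def block_def coord_def)
qed (simp add: vec_integral_def)

subsection \<open>Sobolev functions as primitives\<close>

text \<open>The parameter \<open>c\<close> is the value at \<open>a\<close>. Nested as
  \<open>prim a d (prim a e f)\<close>, it gives the second-order primitive of \<open>f\<close> with
  value \<open>d\<close> and slope \<open>e\<close> at \<open>a\<close>.\<close>

definition prim :: "real \<Rightarrow> real \<Rightarrow> (real \<Rightarrow> real) \<Rightarrow> real \<Rightarrow> real" where
  "prim a c f s = c + indef a f s"

lemma prim_continuous_on: "f \<in> L2_real a b \<Longrightarrow> continuous_on {a..b} (prim a c f)"
  unfolding prim_def by (intro continuous_intros indef_continuous_on)

lemma L2_real_prim: "f \<in> L2_real a b \<Longrightarrow> prim a c f \<in> L2_real a b"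
  by (rule L2_real_continuous_on[OF prim_continuous_on])

lemma has_weak_deriv_prim: "a < b \<Longrightarrow> f \<in> L2_real a b \<Longrightarrow> has_weak_deriv a b 1 (prim a c f) f"
  using has_weak_deriv_indef[of a b f c] by (simp add: prim_def[abs_def])

lemma prim_lower: "prim a c f a = c"
  by (simp add: prim_def indef_lower)

lemma indef_const: "a \<le> s \<Longrightarrow> indef a (\<lambda>_. c) s = (s - a) * c"
  by (simp add: indef_def measure_restrict_space)

text \<open>Integrating the inner constant \<open>e\<close> produces \<open>(s - a) * e\<close>, the
  origin of the block \<open>s - a\<close> in \<open>K_mat\<close>.\<close>

lemma prim_prim:
  assumes "f \<in> L2_real a b" "s \<in> {a..b}"
  shows "prim a d (prim a e f) s = d + (s - a) * e + indef a (indef a f) s"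
proof -
  have "indef a (\<lambda>t. e + indef a f t) s = indef a (\<lambda>_. e) s + indef a (indef a f) s"
    using assms(2)
    by (intro indef_add[OF L2_real_continuous_on[OF continuous_on_const] L2_real_indef[OF assms(1)]]) auto
  then show ?thesis
    using assms by (simp add: prim_def[abs_def] indef_const)
qed

lemma sobolev_real_1_prim:
  assumes "a < b" and f: "f \<in> L2_real a b" and h: "h \<in> L2_real a b" "ae_eq a b h (prim a c f)"
  shows "h \<in> sobolev_real a b 1" "has_weak_deriv a b 1 h f"
    "\<And>s. s \<in> {a..b} \<Longrightarrow> cont_version_real a b h s = prim a c f s"
proof -
  show weak: "has_weak_deriv a b 1 h f"
    by (rule has_weak_deriv_cong_ae_eq[OF ae_eq_sym[OF h(2)] L2_real_prim[OF f] h(1) has_weak_deriv_prim[OF assms(1) f]])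
  have "\<exists>g\<in>L2_real a b. has_weak_deriv a b j h g" if "j \<le> 1" for j
  proof (cases "j = 0")
    case True
    then show ?thesis using has_weak_deriv_0 h(1) by blast
  next
    case False
    then have "j = 1" using that by simp
    then show ?thesis using weak f by blast
  qed
  then show "h \<in> sobolev_real a b 1" using h(1) by (simp add: sobolev_real_def)
  show "cont_version_real a b h s = prim a c f s" if "s \<in> {a..b}" for s
    by (rule cont_version_real_eq[OF assms(1) prim_continuous_on[OF f] h(2) that])
qed

text \<open>The first-order lemma is applied with \<open>prim a e f\<close> in the role of the weak
  derivative. As this function is continuous, it also supplies the point values of the chosen first
  weak derivative of \<open>h\<close>.\<close>

lemma sobolev_real_2_prim:
  assumes "a < b" and f: "f \<in> L2_real a b" and h: "h \<in> L2_real a b" "ae_eq a b h (prim a d (prim a e f))"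
  shows "h \<in> sobolev_real a b 2" "has_weak_deriv a b 2 h f"
    "\<And>s. s \<in> {a..b} \<Longrightarrow> cont_version_real a b h s = prim a d (prim a e f) s"
    "\<And>s. s \<in> {a..b} \<Longrightarrow> cont_version_real a b (weak_deriv_real a b 1 h) s = prim a e f s"
proof -
  have f': "prim a e f \<in> L2_real a b" by (rule L2_real_prim[OF f])
  note 1 = sobolev_real_1_prim[OF assms(1) f' h]
  show weak: "has_weak_deriv a b 2 h f"
    by (rule has_weak_deriv_2[OF 1(2) has_weak_deriv_prim[OF assms(1) f]])
  have "\<exists>g\<in>L2_real a b. has_weak_deriv a b j h g" if "j \<le> 2" for j
  proof (cases "j \<le> 1")
    case True
    then show ?thesis using 1(1) by (simp add: sobolev_real_def)
  next
    case False
    then have "j = 2" using that by simp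
    then show ?thesis using weak f by blast
  qed
  then show "h \<in> sobolev_real a b 2" using h(1) by (simp add: sobolev_real_def)
  show "cont_version_real a b h s = prim a d (prim a e f) s" if "s \<in> {a..b}" for s
    by (rule 1(3)[OF that])
  show "cont_version_real a b (weak_deriv_real a b 1 h) s = prim a e f s" if "s \<in> {a..b}" for s
    by (rule cont_version_real_eq[OF assms(1) prim_continuous_on[OF f] weak_deriv_real_props(3)[OF f' 1(2)] that])
qed

lemma sobolev_real_weak_deriv:
  assumes "h \<in> sobolev_real a b k" "j \<le> k"
  shows "weak_deriv_real a b j h \<in> L2_real a b" "has_weak_deriv a b j h (weak_deriv_real a b j h)"
  using assms by (auto simp: sobolev_real_def dest!: spec[of _ j] intro: weak_deriv_real_props)

lemma sobolev_real_1_imp_prim: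
  assumes "a < b" "h \<in> sobolev_real a b 1"
  shows "\<exists>c. ae_eq a b h (prim a c (weak_deriv_real a b 1 h))"
proof -
  have "h \<in> L2_real a b" using assms by (simp add: sobolev_real_def)
  then show ?thesis
    using has_weak_deriv_imp_indef[OF assms(1) sobolev_real_weak_deriv(2)[OF assms(2)] _ sobolev_real_weak_deriv(1)[OF assms(2)]]
    unfolding prim_def[abs_def] by blast
qed

text \<open>The first-order result is used twice: once for \<open>h\<close> with its weak
  derivative, and once for that derivative, whose own weak derivative is the second one of
  \<open>h\<close>.\<close>

lemma sobolev_real_2_imp_prim:
  assumes "a < b" "h \<in> sobolev_real a b 2"
  shows "\<exists>d e. ae_eq a b h (prim a d (prim a e (weak_deriv_real a b 2 h)))"
proof -
  let ?g = "weak_deriv_real a b 1 h" and ?f = "weak_deriv_real a b 2 h"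
  have h: "h \<in> L2_real a b" using assms by (simp add: sobolev_real_def)
  have g: "?g \<in> L2_real a b" "has_weak_deriv a b 1 h ?g"
    using sobolev_real_weak_deriv[OF assms(2), of 1] by auto
  have f: "?f \<in> L2_real a b" "has_weak_deriv a b 2 h ?f"
    using sobolev_real_weak_deriv[OF assms(2), of 2] by auto
  obtain e where e: "ae_eq a b ?g (prim a e ?f)"
    using has_weak_deriv_imp_indef[OF assms(1) has_weak_deriv_1_of_2[OF g(2) f(2)] g(1) f(1)]
    unfolding prim_def[abs_def] by blast
  obtain d where d: "ae_eq a b h (prim a d ?g)"
    using has_weak_deriv_imp_indef[OF assms(1) g(2) h g(1)] unfolding prim_def[abs_def] by blast
  \<comment> \<open>The inner function is known only up to a null set, which the outer integral does
    not see; the two primitives therefore agree at every point of \<open>{a..b}\<close>.\<close>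
  have "ae_eq a b (prim a d ?g) (prim a d (prim a e ?f))"
  proof (rule ae_eqI)
    fix s assume "s \<in> {a..b}"
    then have "indef a ?g s = indef a (prim a e ?f) s"
      by (intro indef_cong_ae_eq[OF e g(1) L2_real_prim[OF f(1)]]) simp
    then show "prim a d ?g s = prim a d (prim a e ?f) s"
      unfolding prim_def[of a d] by (rule arg_cong)
  qed
  then show ?thesis using ae_eq_trans[OF d] by blast
qed

lemma coord_weak_deriv: "i < m \<Longrightarrow> coord i (weak_deriv a b k m y) = weak_deriv_real a b k (coord i y)"
  by (simp add: coord_def weak_deriv_def)

lemma L2_inner_coords:
  assumes "x \<in> L2 a b m" "y \<in> L2 a b m"
  shows "L2_inner a b x y = (\<Sum>i<m. LINT s|lebesgue_on {a..b}. coord i x s * coord i y s)"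
proof -
  have "L2_inner a b x y = (LINT s|lebesgue_on {a..b}. (\<Sum>i<m. coord i x s * coord i y s))"
    unfolding L2_inner_def
  proof (rule Bochner_Integration.integral_cong[OF refl])
    fix s assume "s \<in> space (lebesgue_on {a..b})"
    then have "dim_vec (y s) = m" using assms by (auto simp: L2_def)
    then show "x s \<bullet> y s = (\<Sum>i<m. coord i x s * coord i y s)"
      by (simp add: scalar_prod_def coord_def lessThan_atLeast0)
  qed
  also have "\<dots> = (\<Sum>i<m. LINT s|lebesgue_on {a..b}. coord i x s * coord i y s)"
    by (rule Bochner_Integration.integral_sum) (use assms in \<open>auto intro: L2_real_integrable_mult L2_coord\<close>)
  finally show ?thesis .
qed

lemma integral_mult_cong_ae_eq:
  assumes "ae_eq a b f f'" "ae_eq a b g g'" "f \<in> L2_real a b" "f' \<in> L2_real a b" "g \<in> L2_real a b" "g' \<in> L2_real a b"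
  shows "(LINT s|lebesgue_on {a..b}. f s * g s) = (LINT s|lebesgue_on {a..b}. f' s * g' s)"
proof (rule integral_cong_ae_eq)
  show "ae_eq a b (\<lambda>s. f s * g s) (\<lambda>s. f' s * g' s)"
    using assms(1,2) unfolding ae_eq_def by (rule eventually_elim2) simp
qed (use assms in \<open>auto intro!: borel_measurable_integrable L2_real_integrable_mult\<close>)

lemma ae_eq_coords:
  assumes "\<And>s. s \<in> {a..b} \<Longrightarrow> x s \<in> carrier_vec m" "\<And>s. s \<in> {a..b} \<Longrightarrow> y s \<in> carrier_vec m"
    and "\<And>i. i < m \<Longrightarrow> ae_eq a b (coord i x) (coord i y)"
  shows "ae_eq a b x y"
proof -
  have "AE s in lebesgue_on {a..b}. \<forall>i\<in>{..<m}. coord i x s = coord i y s"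
    using assms(3) by (intro AE_finite_allI) (auto simp: ae_eq_def)
  moreover have "AE s in lebesgue_on {a..b}. s \<in> {a..b}"
    by (rule AE_I2) simp
  ultimately show ?thesis
    unfolding ae_eq_def
  proof eventually_elim
    case (elim s)
    then show ?case
      using assms(1,2)[of s] by (intro eq_vecI) (auto simp: coord_def)
  qed
qed

lemma ae_eq_coord: "ae_eq a b x y \<Longrightarrow> ae_eq a b (coord i x) (coord i y)"
  unfolding ae_eq_def coord_def by (erule eventually_mono) simp

lemma L2_block: "x \<in> L2 a b n \<Longrightarrow> k + m \<le> n \<Longrightarrow> block k m x \<in> L2 a b m"
  by (simp add: L2_def coord_block) (simp add: block_def)

lemma L2_add:
  assumes "x \<in> L2 a b m" "y \<in> L2 a b m" shows "(\<lambda>s. x s + y s) \<in> L2 a b m"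
proof -
  have "coord i (\<lambda>s. x s + y s) \<in> L2_real a b" if "i < m" for i
  proof (subst L2_real_cong)
    show "(\<lambda>s. coord i x s + coord i y s) \<in> L2_real a b"
      using assms that by (intro L2_real_add L2_coord)
    show "coord i (\<lambda>s. x s + y s) s = coord i x s + coord i y s" if "s \<in> {a..b}" for s
      using assms[unfolded L2_def carrier_vec_def] that \<open>i < m\<close> by (simp add: coord_def)
  qed
  then show ?thesis using assms by (auto simp: L2_def)
qed

lemma L2_smult:
  assumes "x \<in> L2 a b m" shows "(\<lambda>s. c \<cdot>\<^sub>v x s) \<in> L2 a b m"
proof -
  have "coord i (\<lambda>s. c \<cdot>\<^sub>v x s) \<in> L2_real a b" if "i < m" for i
  proof (subst L2_real_cong)
    show "(\<lambda>s. c * coord i x s) \<in> L2_real a b"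
      using assms that by (intro L2_real_cmult L2_coord)
    show "coord i (\<lambda>s. c \<cdot>\<^sub>v x s) s = c * coord i x s" if "s \<in> {a..b}" for s
      using assms[unfolded L2_def carrier_vec_def] that \<open>i < m\<close> by (simp add: coord_def)
  qed
  then show ?thesis using assms by (auto simp: L2_def)
qed

lemma sum_lessThan_add: "(\<Sum>i<m + (n::nat). f i) = (\<Sum>i<m. f i) + (\<Sum>i<n. f (m + i) :: real)"
  by (induction n) (auto simp: algebra_simps)

subsection \<open>The operator\<close>

locale three_PI =
  fixes a b :: real and n0 n1 n2 :: nat and B :: "real mat"
  assumes ab: "a < b"
    and B: "B \<in> carrier_mat (n1 + 2 * n2) (2 * n1 + 4 * n2)"
    and BT: "invertible_mat (B * T_mat a b n1 n2)"
begin

text \<open>The sign is absorbed so that \<open>N_mat *\<^sub>v q\<close> is itself the solution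
  \<open>v\<close> of the boundary equation with inhomogeneity \<open>q\<close>.\<close>

definition N_mat :: "real mat" where
  "N_mat = - (the (mat_inverse (B * T_mat a b n1 n2)) * B)"

text \<open>\<open>Q(s, \<theta>)\<close> does not depend on \<open>s\<close>, so \<open>s\<close> is set to 0.\<close>

definition q_vec :: "(real \<Rightarrow> real Matrix.vec) \<Rightarrow> real Matrix.vec" where
  "q_vec x = vec_integral (2 * n1 + 4 * n2) {a..b} (\<lambda>\<theta>. Q_mat b n0 n1 n2 0 \<theta> *\<^sub>v x \<theta>)"

definition int_consts :: "(real \<Rightarrow> real Matrix.vec) \<Rightarrow> real Matrix.vec" where
  "int_consts x = N_mat *\<^sub>v q_vec x"

abbreviation "M_inv \<equiv> the (mat_inverse (B * T_mat a b n1 n2))"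

section \<open>The boundary condition as a linear system for the constants of integration\<close>

lemma BT_carrier: "B * T_mat a b n1 n2 \<in> carrier_mat (n1 + 2 * n2) (n1 + 2 * n2)"
  using B block_mats_carrier(1) by (rule mult_carrier_mat)

lemmas M_inv = the_mat_inverse[OF BT_carrier BT]

lemma N_mat_carrier: "N_mat \<in> carrier_mat (n1 + 2 * n2) (2 * n1 + 4 * n2)"
  using B M_inv(1) by (simp add: N_mat_def)

lemma q_vec_carrier: "q_vec x \<in> carrier_vec (2 * n1 + 4 * n2)"
  by (simp add: q_vec_def vec_integral_carrier)

lemma int_consts_carrier: "int_consts x \<in> carrier_vec (n1 + 2 * n2)"
  unfolding int_consts_def by (rule mult_mat_vec_carrier[OF N_mat_carrier q_vec_carrier])

text \<open>The left side is \<open>(B T) v + B q\<close>, so invertibility of \<open>B T\<close>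
  gives one and only one solution \<open>v\<close>. The two directions serve different ends:
  existence puts the range of the operator into \<open>X\<close>, uniqueness makes the operator
  onto.\<close>

lemma boundary_condition_iff:
  assumes v: "v \<in> carrier_vec (n1 + 2 * n2)" and q: "q \<in> carrier_vec (2 * n1 + 4 * n2)"
  shows "B *\<^sub>v (T_mat a b n1 n2 *\<^sub>v v + q) = 0\<^sub>v (n1 + 2 * n2) \<longleftrightarrow> v = N_mat *\<^sub>v q"
proof -
  let ?A = "B * T_mat a b n1 n2"
  have Nq: "N_mat *\<^sub>v q = - (M_inv *\<^sub>v (B *\<^sub>v q))"
    using M_inv(1) B q by (simp add: N_mat_def)
  have split: "B *\<^sub>v (T_mat a b n1 n2 *\<^sub>v v + q) = ?A *\<^sub>v v + B *\<^sub>v q"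
    by (simp only: mult_add_distrib_mat_vec[OF B mult_mat_vec_carrier[OF block_mats_carrier(1) v] q]
        assoc_mult_mat_vec[OF B block_mats_carrier(1) v])
  have Bq: "B *\<^sub>v q \<in> carrier_vec (n1 + 2 * n2)" "?A *\<^sub>v v \<in> carrier_vec (n1 + 2 * n2)"
    by (rule mult_mat_vec_carrier[OF B q] mult_mat_vec_carrier[OF BT_carrier v])+
  have minus: "M *\<^sub>v (- u) = - (M *\<^sub>v u)" if "M \<in> carrier_mat m k" "u \<in> carrier_vec k"
    for M :: "real mat" and u :: "real Matrix.vec" and m k
    using that by (intro eq_vecI) auto
  show ?thesis
  proof
    assume "B *\<^sub>v (T_mat a b n1 n2 *\<^sub>v v + q) = 0\<^sub>v (n1 + 2 * n2)"
    then have sum: "?A *\<^sub>v v + B *\<^sub>v q = 0\<^sub>v (n1 + 2 * n2)"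
      unfolding split .
    have eq: "?A *\<^sub>v v = - (B *\<^sub>v q)"
    proof (rule eq_vecI)
      fix i assume "i < dim_vec (- (B *\<^sub>v q))"
      then have i: "i < n1 + 2 * n2" using B by simp
      have "(?A *\<^sub>v v) $ i + (B *\<^sub>v q) $ i = (?A *\<^sub>v v + B *\<^sub>v q) $ i"
        by (rule index_add_vec(1)[symmetric]) (use i carrier_vecD[OF Bq(1)] in simp)
      also have "\<dots> = 0" unfolding sum using i by simp
      finally show "(?A *\<^sub>v v) $ i = (- (B *\<^sub>v q)) $ i"
        using i carrier_vecD[OF Bq(1)] by (simp del: index_mult_mat_vec dim_mult_mat_vec)
    qed (use carrier_vecD[OF Bq(1)] carrier_vecD[OF Bq(2)] in \<open>simp del: dim_mult_mat_vec\<close>)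
    have "v = (M_inv * ?A) *\<^sub>v v" using M_inv v by simp
    also have "\<dots> = M_inv *\<^sub>v (?A *\<^sub>v v)"
      by (rule assoc_mult_mat_vec[OF M_inv(1) BT_carrier v])
    also have "\<dots> = N_mat *\<^sub>v q"
      unfolding eq Nq by (rule minus[OF M_inv(1) Bq(1)])
    finally show "v = N_mat *\<^sub>v q" .
  next
    assume "v = N_mat *\<^sub>v q"
    then have "?A *\<^sub>v v = - (?A *\<^sub>v (M_inv *\<^sub>v (B *\<^sub>v q)))"
      unfolding Nq using minus[OF BT_carrier mult_mat_vec_carrier[OF M_inv(1) Bq(1)]] by simp
    also have "?A *\<^sub>v (M_inv *\<^sub>v (B *\<^sub>v q)) = (?A * M_inv) *\<^sub>v (B *\<^sub>v q)"
      by (rule assoc_mult_mat_vec[OF BT_carrier M_inv(1) Bq(1), symmetric])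
    also have "\<dots> = B *\<^sub>v q" using M_inv(2) Bq(1) by simp
    finally show "B *\<^sub>v (T_mat a b n1 n2 *\<^sub>v v + q) = 0\<^sub>v (n1 + 2 * n2)"
      unfolding split using Bq(1) by simp
  qed
qed

section \<open>The operator evaluated block by block\<close>

lemma Q_mat_mult_blocks:
  assumes "x \<in> L2 a b (n0 + n1 + n2)" "\<theta> \<in> {a..b}"
  shows "Q_mat b n0 n1 n2 s \<theta> *\<^sub>v x \<theta> = 0\<^sub>v n1 @\<^sub>v block n0 n1 x \<theta> @\<^sub>v 0\<^sub>v n2 @\<^sub>v
      ((b - \<theta>) \<cdot>\<^sub>v block (n0 + n1) n2 x \<theta>) @\<^sub>v 0\<^sub>v n2 @\<^sub>v block (n0 + n1) n2 x \<theta>"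
proof -
  have "x \<theta> \<in> carrier_vec (n0 + n1 + n2)" using assms by (simp add: L2_def)
  note eq = block_append[of x \<theta>, OF this]
  show ?thesis
    by (subst eq, rule Q_mat_mult) (rule dim_block)+
qed

lemma L_mat_mult_blocks:
  assumes "x \<in> L2 a b (n0 + n1 + n2)" "\<theta> \<in> {a..b}"
  shows "L_mat n0 n1 n2 s \<theta> *\<^sub>v x \<theta> = 0\<^sub>v n0 @\<^sub>v block n0 n1 x \<theta> @\<^sub>v (s - \<theta>) \<cdot>\<^sub>v block (n0 + n1) n2 x \<theta>"
proof -
  have "x \<theta> \<in> carrier_vec (n0 + n1 + n2)" using assms by (simp add: L2_def)
  note eq = block_append[of x \<theta>, OF this]
  show ?thesis
    by (subst eq, rule L_mat_mult) (rule dim_block)+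
qed

lemma G0_mult_blocks:
  assumes "x \<in> L2 a b (n0 + n1 + n2)" "s \<in> {a..b}"
  shows "G0 n0 n1 n2 s *\<^sub>v x s = block 0 n0 x s @\<^sub>v 0\<^sub>v n1 @\<^sub>v 0\<^sub>v n2"
proof -
  have "x s \<in> carrier_vec (n0 + n1 + n2)" using assms by (simp add: L2_def)
  note eq = block_append[of x s, OF this]
  show ?thesis
    by (subst eq, rule G0_mult) (rule dim_block)+
qed

text \<open>The zero rows belong to the values at \<open>a\<close>, where integration has not yet
  contributed anything. The other rows are what integration adds at \<open>b\<close> to the part
  determined by the constants.\<close>

lemma q_vec_blocks:
  assumes x: "x \<in> L2 a b (n0 + n1 + n2)"
  shows "q_vec x =
    0\<^sub>v n1 @\<^sub>v Matrix.vec n1 (\<lambda>i. indef a (coord (n0 + i) x) b) @\<^sub>v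
    0\<^sub>v n2 @\<^sub>v Matrix.vec n2 (\<lambda>i. indef a (indef a (coord (n0 + n1 + i) x)) b) @\<^sub>v
    0\<^sub>v n2 @\<^sub>v Matrix.vec n2 (\<lambda>i. indef a (coord (n0 + n1 + i) x) b)"
proof -
  \<comment> \<open>The dimension is regrouped to follow the right-nested concatenation, the shape
    in which \<open>vec_integral_append\<close> can peel off one block at a time.\<close>
  have dim: "2 * n1 + 4 * n2 = n1 + (n1 + (n2 + (n2 + (n2 + n2))))" by simp
  have "q_vec x = vec_integral (n1 + (n1 + (n2 + (n2 + (n2 + n2))))) {a..b}
     (\<lambda>\<theta>. 0\<^sub>v n1 @\<^sub>v block n0 n1 x \<theta> @\<^sub>v 0\<^sub>v n2 @\<^sub>v
      ((b - \<theta>) \<cdot>\<^sub>v block (n0 + n1) n2 x \<theta>) @\<^sub>v 0\<^sub>v n2 @\<^sub>v block (n0 + n1) n2 x \<theta>)"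
    unfolding q_vec_def dim by (intro vec_integral_cong Q_mat_mult_blocks x)
  also have "\<dots> = vec_integral n1 {a..b} (\<lambda>_. 0\<^sub>v n1) @\<^sub>v vec_integral n1 {a..b} (block n0 n1 x) @\<^sub>v
      vec_integral n2 {a..b} (\<lambda>_. 0\<^sub>v n2) @\<^sub>v
      vec_integral n2 {a..b} (\<lambda>\<theta>. (b - \<theta>) \<cdot>\<^sub>v block (n0 + n1) n2 x \<theta>) @\<^sub>v
      vec_integral n2 {a..b} (\<lambda>_. 0\<^sub>v n2) @\<^sub>v vec_integral n2 {a..b} (block (n0 + n1) n2 x)"
    by (simp add: vec_integral_append dim_block)
  also have "\<dots> = 0\<^sub>v n1 @\<^sub>v Matrix.vec n1 (\<lambda>i. indef a (coord (n0 + i) x) b) @\<^sub>v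
    0\<^sub>v n2 @\<^sub>v Matrix.vec n2 (\<lambda>i. indef a (indef a (coord (n0 + n1 + i) x)) b) @\<^sub>v
    0\<^sub>v n2 @\<^sub>v Matrix.vec n2 (\<lambda>i. indef a (coord (n0 + n1 + i) x) b)"
    using vec_integral_smult_block[OF x, of "n0 + n1" n2 b]
    by (simp add: vec_integral_zero vec_integral_block)
  finally show ?thesis .
qed

lemma block_integrable:
  assumes "x \<in> L2 a b (n0 + n1 + n2)" "k + m \<le> n0 + n1 + n2" "i < m" "s \<le> b"
  shows "integrable (lebesgue_on {a..s}) (\<lambda>\<theta>. block k m x \<theta> $ i)"
    "integrable (lebesgue_on {a..s}) (\<lambda>\<theta>. ((t - \<theta>) \<cdot>\<^sub>v block k m x \<theta>) $ i)"
proof -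
  have eq: "(\<lambda>\<theta>. block k m x \<theta> $ i) = coord (k + i) x"
    "(\<lambda>\<theta>. ((t - \<theta>) \<cdot>\<^sub>v block k m x \<theta>) $ i) = (\<lambda>\<theta>. coord (k + i) x \<theta> * (t - \<theta>))"
    using \<open>i < m\<close> by (auto simp: block_def coord_def)
  have "integrable (lebesgue_on {a..s}) (coord (k + i) x)"
    using assms by (intro L2_coord_integrable) auto
  then show "integrable (lebesgue_on {a..s}) (\<lambda>\<theta>. block k m x \<theta> $ i)"
    "integrable (lebesgue_on {a..s}) (\<lambda>\<theta>. ((t - \<theta>) \<cdot>\<^sub>v block k m x \<theta>) $ i)"
    unfolding eq by (auto intro!: integrable_mult_continuous_on continuous_intros)
qed

lemma Q_mat_mult_integrable:
  assumes x: "x \<in> L2 a b (n0 + n1 + n2)" and j: "j < 2 * n1 + 4 * n2"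
  shows "integrable (lebesgue_on {a..b}) (\<lambda>\<theta>. (Q_mat b n0 n1 n2 s \<theta> *\<^sub>v x \<theta>) $ j)"
proof -
  have "integrable (lebesgue_on {a..b}) (\<lambda>\<theta>. (0\<^sub>v n1 @\<^sub>v block n0 n1 x \<theta> @\<^sub>v 0\<^sub>v n2 @\<^sub>v
      ((b - \<theta>) \<cdot>\<^sub>v block (n0 + n1) n2 x \<theta>) @\<^sub>v 0\<^sub>v n2 @\<^sub>v block (n0 + n1) n2 x \<theta>) $ j)"
    by (rule integrable_append_vec block_integrable[OF x] | use j in \<open>simp add: dim_block\<close>)+
  then show ?thesis
    by (subst Bochner_Integration.integrable_cong[OF refl]) (use Q_mat_mult_blocks[OF x] in auto)
qed

lemma L_mat_mult_integrable:
  assumes x: "x \<in> L2 a b (n0 + n1 + n2)" and j: "j < n0 + n1 + n2" and s: "s \<in> {a..b}"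
  shows "integrable (lebesgue_on {a..s}) (\<lambda>\<theta>. (L_mat n0 n1 n2 t \<theta> *\<^sub>v x \<theta>) $ j)"
proof -
  have "integrable (lebesgue_on {a..s}) (\<lambda>\<theta>. (0\<^sub>v n0 @\<^sub>v block n0 n1 x \<theta> @\<^sub>v (t - \<theta>) \<cdot>\<^sub>v block (n0 + n1) n2 x \<theta>) $ j)"
    by (rule integrable_append_vec block_integrable[OF x] | use j s in \<open>simp add: dim_block\<close>)+
  then show ?thesis
    by (subst Bochner_Integration.integrable_cong[OF refl]) (use L_mat_mult_blocks[OF x] s in auto)
qed

text \<open>The factorisation separates the variables: \<open>K_mat\<close> carries
  \<open>s\<close>, \<open>Q_mat\<close> carries \<open>\<theta>\<close>, and \<open>N_mat\<close>
  is constant.\<close>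

lemma G2_eq: "G2 a b n0 n1 n2 B s \<theta> = K_mat a n0 n1 n2 s * N_mat * Q_mat b n0 n1 n2 0 \<theta>"
proof -
  note c = B M_inv(1) block_mats_carrier(3)[of a n0 n1 n2 s] block_mats_carrier(2)[of b n0 n1 n2 0 \<theta>]
  have "K_mat a n0 n1 n2 s * N_mat = - (K_mat a n0 n1 n2 s * M_inv * B)"
    using c by (simp add: N_mat_def assoc_mult_mat[OF c(3,2,1)])
  moreover have "Q_mat b n0 n1 n2 s \<theta> = Q_mat b n0 n1 n2 0 \<theta>"
    by (simp add: Q_mat_def)
  ultimately show ?thesis
    using c by (simp add: G2_def)
qed

lemma G2_mult:
  assumes "x \<theta> \<in> carrier_vec (n0 + n1 + n2)"
  shows "G2 a b n0 n1 n2 B s \<theta> *\<^sub>v x \<theta> =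
    (K_mat a n0 n1 n2 s * N_mat) *\<^sub>v (Q_mat b n0 n1 n2 0 \<theta> *\<^sub>v x \<theta>)"
  unfolding G2_eq
  by (rule assoc_mult_mat_vec[OF mult_carrier_mat[OF block_mats_carrier(3) N_mat_carrier] block_mats_carrier(2) assms])

lemma G1_mult:
  assumes "x \<theta> \<in> carrier_vec (n0 + n1 + n2)"
  shows "G1 a b n0 n1 n2 B s \<theta> *\<^sub>v x \<theta> =
    L_mat n0 n1 n2 s \<theta> *\<^sub>v x \<theta> + (K_mat a n0 n1 n2 s * N_mat) *\<^sub>v (Q_mat b n0 n1 n2 0 \<theta> *\<^sub>v x \<theta>)"
proof -
  have "G2 a b n0 n1 n2 B s \<theta> \<in> carrier_mat (n0 + n1 + n2) (n0 + n1 + n2)"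
    unfolding G2_eq
    by (rule mult_carrier_mat[OF mult_carrier_mat[OF block_mats_carrier(3) N_mat_carrier] block_mats_carrier(2)])
  then show ?thesis
    unfolding G1_def G2_mult[of x \<theta>, OF assms, symmetric]
    by (subst add_mult_distrib_mat_vec[OF block_mats_carrier(4)[unfolded L_mat_def]])
      (auto simp: assms L_mat_def)
qed

text \<open>The summand common to \<open>G1\<close> and \<open>G2\<close> is integrated over
  \<open>{a..s}\<close> and over \<open>{s..b}\<close>, together over \<open>{a..b}\<close>, where
  it yields \<open>K_mat\<close> applied to \<open>int_consts x\<close>. What remains of
  \<open>G1\<close> gives the single and the double primitive from \<open>a\<close>, and
  \<open>G0\<close> copies the first block.\<close>

lemma T_op_blocks:
  assumes x: "x \<in> L2 a b (n0 + n1 + n2)" and s: "s \<in> {a..b}"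
  shows "T_op a b n0 n1 n2 B x s =
    block 0 n0 x s @\<^sub>v
    Matrix.vec n1 (\<lambda>i. int_consts x $ i + indef a (coord (n0 + i) x) s) @\<^sub>v
    Matrix.vec n2 (\<lambda>i. int_consts x $ (n1 + i) + (s - a) * int_consts x $ (n1 + n2 + i) +
      indef a (indef a (coord (n0 + n1 + i) x)) s)"
proof -
  let ?n = "n0 + n1 + n2" and ?A = "K_mat a n0 n1 n2 s * N_mat"
  let ?L = "\<lambda>\<theta>. L_mat n0 n1 n2 s \<theta> *\<^sub>v x \<theta>" and ?Q = "\<lambda>\<theta>. Q_mat b n0 n1 n2 0 \<theta> *\<^sub>v x \<theta>"
  have xc: "x \<theta> \<in> carrier_vec ?n" if "\<theta> \<in> {a..b}" for \<theta> using x that by (simp add: L2_def)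
  have A: "?A \<in> carrier_mat ?n (2 * n1 + 4 * n2)"
    by (rule mult_carrier_mat[OF block_mats_carrier(3) N_mat_carrier])
  have dimL: "dim_vec (?L \<theta>) = ?n" for \<theta>
    using block_mats_carrier(4)[of n0 n1 n2 s \<theta>] by simp
  have dimQ: "dim_vec (?Q \<theta>) = 2 * n1 + 4 * n2" for \<theta>
    using block_mats_carrier(2)[of b n0 n1 n2 0 \<theta>] by simp
  have dimA: "dim_vec (?A *\<^sub>v u) = ?n" for u
    unfolding dim_mult_mat_vec by (rule carrier_matD(1)[OF A])
  have intA: "integrable (lebesgue_on {a..b}) (\<lambda>\<theta>. (?A *\<^sub>v ?Q \<theta>) $ i)" if "i < ?n" for i
    by (rule integrable_mult_mat_vec[OF A that dimQ Q_mat_mult_integrable[OF x]])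
  have intA': "integrable (lebesgue_on {a..s}) (\<lambda>\<theta>. (?A *\<^sub>v ?Q \<theta>) $ i)" if "i < ?n" for i
    by (rule integrable_subinterval[OF intA[OF that]]) (use s in auto)
  have V1: "vec_integral ?n {a..s} (\<lambda>\<theta>. G1 a b n0 n1 n2 B s \<theta> *\<^sub>v x \<theta>) =
      vec_integral ?n {a..s} ?L + vec_integral ?n {a..s} (\<lambda>\<theta>. ?A *\<^sub>v ?Q \<theta>)"
  proof -
    have "vec_integral ?n {a..s} (\<lambda>\<theta>. G1 a b n0 n1 n2 B s \<theta> *\<^sub>v x \<theta>) =
        vec_integral ?n {a..s} (\<lambda>\<theta>. ?L \<theta> + ?A *\<^sub>v ?Q \<theta>)"
      using s by (intro vec_integral_cong G1_mult xc) auto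
    then show ?thesis
      by (simp only: vec_integral_add[OF dimL dimA L_mat_mult_integrable[OF x _ s] intA'])
  qed
  have V2: "vec_integral ?n {s..b} (\<lambda>\<theta>. G2 a b n0 n1 n2 B s \<theta> *\<^sub>v x \<theta>) =
      vec_integral ?n {s..b} (\<lambda>\<theta>. ?A *\<^sub>v ?Q \<theta>)"
    using s by (intro vec_integral_cong G2_mult xc) auto
  have V: "vec_integral ?n {a..s} (\<lambda>\<theta>. ?A *\<^sub>v ?Q \<theta>) + vec_integral ?n {s..b} (\<lambda>\<theta>. ?A *\<^sub>v ?Q \<theta>) =
      K_mat a n0 n1 n2 s *\<^sub>v int_consts x"
  proof -
    have "vec_integral ?n {a..s} (\<lambda>\<theta>. ?A *\<^sub>v ?Q \<theta>) + vec_integral ?n {s..b} (\<lambda>\<theta>. ?A *\<^sub>v ?Q \<theta>) =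
        vec_integral ?n {a..b} (\<lambda>\<theta>. ?A *\<^sub>v ?Q \<theta>)"
      by (rule vec_integral_combine[OF intA s])
    also have "\<dots> = ?A *\<^sub>v q_vec x"
      unfolding q_vec_def by (rule vec_integral_mult_mat_vec[OF A dimQ Q_mat_mult_integrable[OF x]])
    also have "\<dots> = K_mat a n0 n1 n2 s *\<^sub>v int_consts x"
      unfolding int_consts_def by (rule assoc_mult_mat_vec[OF block_mats_carrier(3) N_mat_carrier q_vec_carrier])
    finally show ?thesis .
  qed
  have L: "vec_integral ?n {a..s} ?L = 0\<^sub>v n0 @\<^sub>v
      Matrix.vec n1 (\<lambda>i. indef a (coord (n0 + i) x) s) @\<^sub>v
      Matrix.vec n2 (\<lambda>i. indef a (indef a (coord (n0 + n1 + i) x)) s)"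
  proof -
    have "vec_integral ?n {a..s} ?L = vec_integral (n0 + (n1 + n2)) {a..s}
        (\<lambda>\<theta>. 0\<^sub>v n0 @\<^sub>v block n0 n1 x \<theta> @\<^sub>v (s - \<theta>) \<cdot>\<^sub>v block (n0 + n1) n2 x \<theta>)"
      unfolding add.assoc using s by (intro vec_integral_cong L_mat_mult_blocks[OF x, unfolded add.assoc]) auto
    also have "\<dots> = vec_integral n0 {a..s} (\<lambda>_. 0\<^sub>v n0) @\<^sub>v vec_integral n1 {a..s} (block n0 n1 x) @\<^sub>v
        vec_integral n2 {a..s} (\<lambda>\<theta>. (s - \<theta>) \<cdot>\<^sub>v block (n0 + n1) n2 x \<theta>)"
      by (simp add: vec_integral_append dim_block)
    finally show ?thesis
      using vec_integral_smult_block[OF x, of "n0 + n1" n2 s] s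
      by (simp add: vec_integral_zero vec_integral_block)
  qed
  have K: "K_mat a n0 n1 n2 s *\<^sub>v int_consts x = 0\<^sub>v n0 @\<^sub>v Matrix.vec n1 (($) (int_consts x)) @\<^sub>v
     (Matrix.vec n2 (\<lambda>i. int_consts x $ (n1 + i)) + (s - a) \<cdot>\<^sub>v Matrix.vec n2 (\<lambda>i. int_consts x $ (n1 + n2 + i)))"
    by (subst vec_three_blocks[OF int_consts_carrier]) (rule K_mat_mult; simp)
  let ?V = "vec_integral ?n {a..s} (\<lambda>\<theta>. ?A *\<^sub>v ?Q \<theta>)" and ?W = "vec_integral ?n {s..b} (\<lambda>\<theta>. ?A *\<^sub>v ?Q \<theta>)"
  have "T_op a b n0 n1 n2 B x s = G0 n0 n1 n2 s *\<^sub>v x s + (vec_integral ?n {a..s} ?L + ?V) + ?W"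
    unfolding T_op_def PI_op_def V1 V2 ..
  also have "\<dots> = G0 n0 n1 n2 s *\<^sub>v x s + (vec_integral ?n {a..s} ?L + (?V + ?W))"
    using vec_integral_carrier[of ?n] mult_mat_vec_carrier[OF block_mats_carrier(5) xc[OF s]]
    by (simp add: assoc_add_vec[of _ ?n])
  also have "\<dots> = (block 0 n0 x s @\<^sub>v 0\<^sub>v n1 @\<^sub>v 0\<^sub>v n2) +
      ((0\<^sub>v n0 @\<^sub>v Matrix.vec n1 (\<lambda>i. indef a (coord (n0 + i) x) s) @\<^sub>v
        Matrix.vec n2 (\<lambda>i. indef a (indef a (coord (n0 + n1 + i) x)) s)) +
       (0\<^sub>v n0 @\<^sub>v Matrix.vec n1 (($) (int_consts x)) @\<^sub>v
         (Matrix.vec n2 (\<lambda>i. int_consts x $ (n1 + i)) + (s - a) \<cdot>\<^sub>v Matrix.vec n2 (\<lambda>i. int_consts x $ (n1 + n2 + i)))))"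
    unfolding V L K G0_mult_blocks[OF x s] ..
  also have "\<dots> = block 0 n0 x s @\<^sub>v
    Matrix.vec n1 (\<lambda>i. int_consts x $ i + indef a (coord (n0 + i) x) s) @\<^sub>v
    Matrix.vec n2 (\<lambda>i. int_consts x $ (n1 + i) + (s - a) * int_consts x $ (n1 + n2 + i) +
      indef a (indef a (coord (n0 + n1 + i) x)) s)"
    by (intro eq_vecI) (auto simp: block_def)
  finally show ?thesis .
qed

section \<open>Functions obtained from a given function by integration with arbitrary
  constants\<close>

text \<open>\<open>w\<close> arises from \<open>x\<close> by integration, with constants of integration \<open>v = (c, d, e)\<close>.\<close>

definition represents ::
  "(real \<Rightarrow> real Matrix.vec) \<Rightarrow> real Matrix.vec \<Rightarrow> (real \<Rightarrow> real Matrix.vec) \<Rightarrow> bool" where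
  "represents x v w \<longleftrightarrow>
    (\<forall>s\<in>{a..b}. w s \<in> carrier_vec (n0 + n1 + n2)) \<and>
    (\<forall>i<n0 + n1 + n2. coord i w \<in> L2_real a b) \<and>
    (\<forall>i<n0. ae_eq a b (coord i w) (coord i x)) \<and>
    (\<forall>i<n1. ae_eq a b (coord (n0 + i) w) (prim a (v $ i) (coord (n0 + i) x))) \<and>
    (\<forall>i<n2. ae_eq a b (coord (n0 + n1 + i) w)
      (prim a (v $ (n1 + i)) (prim a (v $ (n1 + n2 + i)) (coord (n0 + n1 + i) x))))"

lemma coord_T_op:
  assumes x: "x \<in> L2 a b (n0 + n1 + n2)" and s: "s \<in> {a..b}"
  shows "i < n0 \<Longrightarrow> coord i (T_op a b n0 n1 n2 B x) s = coord i x s"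
    "i < n1 \<Longrightarrow> coord (n0 + i) (T_op a b n0 n1 n2 B x) s = prim a (int_consts x $ i) (coord (n0 + i) x) s"
    "i < n2 \<Longrightarrow> coord (n0 + n1 + i) (T_op a b n0 n1 n2 B x) s =
      prim a (int_consts x $ (n1 + i)) (prim a (int_consts x $ (n1 + n2 + i)) (coord (n0 + n1 + i) x)) s"
  using T_op_blocks[OF x s] prim_prim[OF L2_coord[OF x] s, of "n0 + n1 + i"]
  by (auto simp: coord_def block_def prim_def)

lemma T_op_carrier:
  assumes "x \<in> L2 a b (n0 + n1 + n2)" "s \<in> {a..b}"
  shows "T_op a b n0 n1 n2 B x s \<in> carrier_vec (n0 + n1 + n2)"
  unfolding T_op_blocks[OF assms] by (rule carrier_vecI) (simp add: dim_block)

lemma coord_index_cases: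
  assumes "i < n0 + n1 + n2"
  obtains "i < n0" | j where "i = n0 + j" "j < n1" | j where "i = n0 + n1 + j" "j < n2"
proof -
  consider "i < n0" | "n0 \<le> i" "i < n0 + n1" | "n0 + n1 \<le> i" by linarith
  then show thesis
  proof cases
    case 2
    then show thesis using that(2)[of "i - n0"] by auto
  next
    case 3
    then show thesis using that(3)[of "i - n0 - n1"] assms by auto
  qed (use that(1) in blast)
qed

lemma represents_T_op:
  assumes x: "x \<in> L2 a b (n0 + n1 + n2)"
  shows "represents x (int_consts x) (T_op a b n0 n1 n2 B x)"
proof -
  let ?w = "T_op a b n0 n1 n2 B x"
  have "coord i ?w \<in> L2_real a b" if "i < n0 + n1 + n2" for i
    using that
  proof (cases rule: coord_index_cases)
    case 1
    have "coord i ?w \<in> L2_real a b \<longleftrightarrow> coord i x \<in> L2_real a b"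
      by (rule L2_real_cong) (rule coord_T_op(1)[OF x _ 1])
    then show ?thesis using L2_coord[OF x that] by simp
  next
    case (2 j)
    have "coord i ?w \<in> L2_real a b \<longleftrightarrow> prim a (int_consts x $ j) (coord (n0 + j) x) \<in> L2_real a b"
      unfolding 2 by (rule L2_real_cong) (rule coord_T_op(2)[OF x _ 2(2)])
    then show ?thesis using L2_coord[OF x that] 2 by (simp add: L2_real_prim)
  next
    case (3 j)
    have "coord i ?w \<in> L2_real a b \<longleftrightarrow>
        prim a (int_consts x $ (n1 + j)) (prim a (int_consts x $ (n1 + n2 + j)) (coord (n0 + n1 + j) x)) \<in> L2_real a b"
      unfolding 3 by (rule L2_real_cong) (rule coord_T_op(3)[OF x _ 3(2)])
    then show ?thesis using L2_coord[OF x that] 3 by (simp add: L2_real_prim)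
  qed
  then show ?thesis
    unfolding represents_def using T_op_carrier[OF x] coord_T_op[OF x]
    by (auto intro!: ae_eqI)
qed

text \<open>All data of \<open>w\<close> that enter \<open>X_space\<close> and
  \<open>X_inner\<close>, namely regularity, weak derivatives and point values, are expressed here
  through \<open>x\<close> and \<open>v\<close>.\<close>

lemma represents_sobolev:
  assumes x: "x \<in> L2 a b (n0 + n1 + n2)" and r: "represents x v w"
  shows "i < n1 \<Longrightarrow> coord (n0 + i) w \<in> sobolev_real a b 1"
    "i < n1 \<Longrightarrow> has_weak_deriv a b 1 (coord (n0 + i) w) (coord (n0 + i) x)"
    "i < n1 \<Longrightarrow> s \<in> {a..b} \<Longrightarrow>
      cont_version_real a b (coord (n0 + i) w) s = prim a (v $ i) (coord (n0 + i) x) s"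
    "i < n2 \<Longrightarrow> coord (n0 + n1 + i) w \<in> sobolev_real a b 2"
    "i < n2 \<Longrightarrow> has_weak_deriv a b 2 (coord (n0 + n1 + i) w) (coord (n0 + n1 + i) x)"
    "i < n2 \<Longrightarrow> s \<in> {a..b} \<Longrightarrow> cont_version_real a b (coord (n0 + n1 + i) w) s =
      prim a (v $ (n1 + i)) (prim a (v $ (n1 + n2 + i)) (coord (n0 + n1 + i) x)) s"
    "i < n2 \<Longrightarrow> s \<in> {a..b} \<Longrightarrow> cont_version_real a b (weak_deriv_real a b 1 (coord (n0 + n1 + i) w)) s =
      prim a (v $ (n1 + n2 + i)) (coord (n0 + n1 + i) x) s"
proof -
  assume "i < n1"
  then have "coord (n0 + i) x \<in> L2_real a b" "coord (n0 + i) w \<in> L2_real a b"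
    "ae_eq a b (coord (n0 + i) w) (prim a (v $ i) (coord (n0 + i) x))"
    using r L2_coord[OF x, of "n0 + i"] by (auto simp: represents_def)
  note * = sobolev_real_1_prim[OF ab this]
  show "coord (n0 + i) w \<in> sobolev_real a b 1"
    "has_weak_deriv a b 1 (coord (n0 + i) w) (coord (n0 + i) x)"
    "s \<in> {a..b} \<Longrightarrow> cont_version_real a b (coord (n0 + i) w) s = prim a (v $ i) (coord (n0 + i) x) s"
    using * by auto
next
  assume "i < n2"
  then have "coord (n0 + n1 + i) x \<in> L2_real a b" "coord (n0 + n1 + i) w \<in> L2_real a b"
    "ae_eq a b (coord (n0 + n1 + i) w)
      (prim a (v $ (n1 + i)) (prim a (v $ (n1 + n2 + i)) (coord (n0 + n1 + i) x)))"
    using r L2_coord[OF x, of "n0 + n1 + i"] by (auto simp: represents_def)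
  note * = sobolev_real_2_prim[OF ab this]
  show "coord (n0 + n1 + i) w \<in> sobolev_real a b 2"
    "has_weak_deriv a b 2 (coord (n0 + n1 + i) w) (coord (n0 + n1 + i) x)"
    "s \<in> {a..b} \<Longrightarrow> cont_version_real a b (coord (n0 + n1 + i) w) s =
      prim a (v $ (n1 + i)) (prim a (v $ (n1 + n2 + i)) (coord (n0 + n1 + i) x)) s"
    "s \<in> {a..b} \<Longrightarrow> cont_version_real a b (weak_deriv_real a b 1 (coord (n0 + n1 + i) w)) s =
      prim a (v $ (n1 + n2 + i)) (coord (n0 + n1 + i) x) s"
    using * by auto
qed

lemma represents_L2: "represents x v w \<Longrightarrow> w \<in> L2 a b (n0 + n1 + n2)"
  by (simp add: represents_def L2_def)

lemma weak_deriv_props_represents: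
  assumes x: "x \<in> L2 a b (n0 + n1 + n2)" and r: "represents x v w"
  shows "weak_deriv a b 1 n1 (block n0 n1 w) \<in> L2 a b n1"
    "i < n1 \<Longrightarrow> ae_eq a b (coord i (weak_deriv a b 1 n1 (block n0 n1 w))) (coord (n0 + i) x)"
    "weak_deriv a b 2 n2 (block (n0 + n1) n2 w) \<in> L2 a b n2"
    "j < n2 \<Longrightarrow> ae_eq a b (coord j (weak_deriv a b 2 n2 (block (n0 + n1) n2 w))) (coord (n0 + n1 + j) x)"
proof -
  have *: "i < n1 \<Longrightarrow> coord (n0 + i) x \<in> L2_real a b" "j < n2 \<Longrightarrow> coord (n0 + n1 + j) x \<in> L2_real a b" for i j
    using L2_coord[OF x] by auto
  show "weak_deriv a b 1 n1 (block n0 n1 w) \<in> L2 a b n1"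
    using weak_deriv_real_props(1)[OF *(1) represents_sobolev(2)[OF x r]]
    by (auto simp: L2_def coord_weak_deriv coord_block) (simp add: weak_deriv_def)
  show "weak_deriv a b 2 n2 (block (n0 + n1) n2 w) \<in> L2 a b n2"
    using weak_deriv_real_props(1)[OF *(2) represents_sobolev(5)[OF x r]]
    by (auto simp: L2_def coord_weak_deriv coord_block) (simp add: weak_deriv_def)
  show "i < n1 \<Longrightarrow> ae_eq a b (coord i (weak_deriv a b 1 n1 (block n0 n1 w))) (coord (n0 + i) x)"
    using weak_deriv_real_props(3)[OF *(1) represents_sobolev(2)[OF x r]]
    by (simp add: coord_weak_deriv coord_block)
  show "j < n2 \<Longrightarrow> ae_eq a b (coord j (weak_deriv a b 2 n2 (block (n0 + n1) n2 w))) (coord (n0 + n1 + j) x)"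
    using weak_deriv_real_props(3)[OF *(2) represents_sobolev(5)[OF x r]]
    by (simp add: coord_weak_deriv coord_block)
qed

text \<open>Differentiation removes the constants \<open>v\<close> and \<open>v'\<close>: the weak
  derivatives in \<open>X_inner\<close> agree almost everywhere with the blocks of \<open>x\<close>
  and \<open>y\<close>, and the three sums over blocks add up to the full inner product.\<close>

lemma X_inner_represents:
  assumes x: "x \<in> L2 a b (n0 + n1 + n2)" and y: "y \<in> L2 a b (n0 + n1 + n2)"
    and r: "represents x v w" "represents y v' w'"
  shows "X_inner a b n0 n1 n2 w w' = L2_inner a b x y"
proof -
  let ?I = "\<lambda>i. LINT s|lebesgue_on {a..b}. coord i x s * coord i y s"
  note wx = weak_deriv_props_represents[OF x r(1)] and wy = weak_deriv_props_represents[OF y r(2)]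
  note L = L2_coord[OF x] L2_coord[OF y]
  have "L2_inner a b (block 0 n0 w) (block 0 n0 w') =
      (\<Sum>i<n0. LINT s|lebesgue_on {a..b}. coord i w s * coord i w' s)"
    by (subst L2_inner_coords[where m = n0])
      (auto intro!: L2_block[OF represents_L2[OF r(1)]] L2_block[OF represents_L2[OF r(2)]] simp: coord_block)
  also have "\<dots> = (\<Sum>i<n0. ?I i)"
    by (rule sum.cong[OF refl], rule integral_mult_cong_ae_eq)
      (use r L in \<open>auto simp: represents_def\<close>)
  finally have 0: "L2_inner a b (block 0 n0 w) (block 0 n0 w') = (\<Sum>i<n0. ?I i)" .
  have 1: "L2_inner a b (weak_deriv a b 1 n1 (block n0 n1 w)) (weak_deriv a b 1 n1 (block n0 n1 w')) =
      (\<Sum>i<n1. ?I (n0 + i))"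
    unfolding L2_inner_coords[OF wx(1) wy(1)]
    by (rule sum.cong[OF refl], rule integral_mult_cong_ae_eq)
      (use wx(2) wy(2) L L2_coord[OF wx(1)] L2_coord[OF wy(1)] in auto)
  have 2: "L2_inner a b (weak_deriv a b 2 n2 (block (n0 + n1) n2 w)) (weak_deriv a b 2 n2 (block (n0 + n1) n2 w')) =
      (\<Sum>i<n2. ?I (n0 + n1 + i))"
    unfolding L2_inner_coords[OF wx(3) wy(3)]
    by (rule sum.cong[OF refl], rule integral_mult_cong_ae_eq)
      (use wx(4) wy(4) L L2_coord[OF wx(3)] L2_coord[OF wy(3)] in auto)
  show ?thesis
    unfolding X_inner_def 0 1 2 L2_inner_coords[OF x y] by (simp add: sum_lessThan_add)
qed

text \<open>Values at \<open>a\<close> are the constants themselves; values at \<open>b\<close> add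
  to them the slope term and the integrals of \<open>x\<close>. The boundary vector is therefore
  \<open>T v + q\<close>, and the linear system decides membership.\<close>

lemma X_space_represents_iff:
  assumes x: "x \<in> L2 a b (n0 + n1 + n2)" and v: "v \<in> carrier_vec (n1 + 2 * n2)" and r: "represents x v w"
  shows "w \<in> X_space a b n0 n1 n2 B \<longleftrightarrow> v = int_consts x"
proof -
  let ?x1 = "block n0 n1 w" and ?x2 = "block (n0 + n1) n2 w"
  let ?u1 = "cont_version a b n1 ?x1" and ?u2 = "cont_version a b n2 ?x2"
  let ?u2s = "cont_version a b n2 (weak_deriv a b 1 n2 ?x2)"
  let ?c = "Matrix.vec n1 (($) v)" and ?d = "Matrix.vec n2 (\<lambda>i. v $ (n1 + i))"
    and ?e = "Matrix.vec n2 (\<lambda>i. v $ (n1 + n2 + i))"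
  let ?I1 = "Matrix.vec n1 (\<lambda>i. indef a (coord (n0 + i) x) b)"
    and ?J2 = "Matrix.vec n2 (\<lambda>i. indef a (indef a (coord (n0 + n1 + i) x)) b)"
    and ?I2 = "Matrix.vec n2 (\<lambda>i. indef a (coord (n0 + n1 + i) x) b)"
  note sob = represents_sobolev[OF x r]
  have ab_in: "a \<in> {a..b}" "b \<in> {a..b}" using ab by auto
  have x2: "i < n2 \<Longrightarrow> coord (n0 + n1 + i) x \<in> L2_real a b" for i
    using L2_coord[OF x] by auto
  have u1: "?u1 a = ?c" "?u1 b = ?c + ?I1"
    using ab_in by (auto simp: cont_version_def coord_block sob(3) prim_lower intro!: eq_vecI) (simp add: prim_def)
  have u2: "?u2 a = ?d" "?u2 b = (?d + (b - a) \<cdot>\<^sub>v ?e) + ?J2"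
    using ab_in by (auto simp: cont_version_def coord_block sob(6) prim_lower prim_prim[OF x2] intro!: eq_vecI)
  have wd: "coord i (weak_deriv a b 1 n2 ?x2) = weak_deriv_real a b 1 (coord (n0 + n1 + i) w)" if "i < n2" for i
    unfolding coord_weak_deriv[OF that] coord_block[OF that] ..
  have u2s: "?u2s a = ?e" "?u2s b = ?e + ?I2"
    using ab_in by (auto simp: cont_version_def wd sob(7) prim_lower simp del: One_nat_def intro!: eq_vecI) (simp add: prim_def)
  have "?u1 a @\<^sub>v ?u1 b @\<^sub>v ?u2 a @\<^sub>v ?u2 b @\<^sub>v ?u2s a @\<^sub>v ?u2s b =
      (?c @\<^sub>v ?c @\<^sub>v ?d @\<^sub>v (?d + (b - a) \<cdot>\<^sub>v ?e) @\<^sub>v ?e @\<^sub>v ?e) +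
      (0\<^sub>v n1 @\<^sub>v ?I1 @\<^sub>v 0\<^sub>v n2 @\<^sub>v ?J2 @\<^sub>v 0\<^sub>v n2 @\<^sub>v ?I2)"
    unfolding u1 u2 u2s by (simp add: append_vec_add_dim zero_add_vec_dim)
  also have "?c @\<^sub>v ?c @\<^sub>v ?d @\<^sub>v (?d + (b - a) \<cdot>\<^sub>v ?e) @\<^sub>v ?e @\<^sub>v ?e =
      T_mat a b n1 n2 *\<^sub>v (?c @\<^sub>v ?d @\<^sub>v ?e)"
    by (rule T_mat_mult[symmetric]) auto
  also have "?c @\<^sub>v ?d @\<^sub>v ?e = v"
    by (rule vec_three_blocks[OF v, symmetric])
  also have "0\<^sub>v n1 @\<^sub>v ?I1 @\<^sub>v 0\<^sub>v n2 @\<^sub>v ?J2 @\<^sub>v 0\<^sub>v n2 @\<^sub>v ?I2 = q_vec x"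
    by (rule q_vec_blocks[OF x, symmetric])
  finally have bd: "?u1 a @\<^sub>v ?u1 b @\<^sub>v ?u2 a @\<^sub>v ?u2 b @\<^sub>v ?u2s a @\<^sub>v ?u2s b = T_mat a b n1 n2 *\<^sub>v v + q_vec x" .
  have "block 0 n0 w \<in> L2 a b n0"
    by (rule L2_block[OF represents_L2[OF r]]) simp
  moreover have "?x1 \<in> sobolev a b 1 n1" "?x2 \<in> sobolev a b 2 n2"
    using sob(1,4) by (auto simp: sobolev_def coord_block) (auto simp: block_def)
  moreover have "\<forall>s\<in>{a..b}. w s \<in> carrier_vec (n0 + n1 + n2)"
    using r by (simp add: represents_def)
  ultimately have "w \<in> X_space a b n0 n1 n2 B \<longleftrightarrow>
      B *\<^sub>v (T_mat a b n1 n2 *\<^sub>v v + q_vec x) = 0\<^sub>v (n1 + 2 * n2)"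
    unfolding X_space_def Let_def mem_Collect_eq bd by simp
  then show ?thesis
    unfolding boundary_condition_iff[OF v q_vec_carrier] int_consts_def .
qed

lemma X_space_imp_represents:
  assumes w: "w \<in> X_space a b n0 n1 n2 B"
  obtains x v where "x \<in> L2 a b (n0 + n1 + n2)" "v \<in> carrier_vec (n1 + 2 * n2)" "represents x v w"
proof -
  have wc: "\<forall>s\<in>{a..b}. w s \<in> carrier_vec (n0 + n1 + n2)"
    and w0: "block 0 n0 w \<in> L2 a b n0" and w1: "block n0 n1 w \<in> sobolev a b 1 n1"
    and w2: "block (n0 + n1) n2 w \<in> sobolev a b 2 n2"
    using w by (auto simp: X_space_def Let_def)
  have w0: "i < n0 \<Longrightarrow> coord i w \<in> L2_real a b" for i
    using L2_coord[OF w0] by (simp add: coord_block)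
  have w1: "i < n1 \<Longrightarrow> coord (n0 + i) w \<in> sobolev_real a b 1" for i
    using w1 by (auto simp: sobolev_def coord_block)
  have w2: "i < n2 \<Longrightarrow> coord (n0 + n1 + i) w \<in> sobolev_real a b 2" for i
    using w2 by (auto simp: sobolev_def coord_block)
  \<comment> \<open>The candidate preimage: the first block unchanged, one weak derivative in the
    second block, two in the third.\<close>
  define x where "x = (\<lambda>s. Matrix.vec (n0 + n1 + n2) (\<lambda>i. if i < n0 then coord i w s
      else if i < n0 + n1 then weak_deriv_real a b 1 (coord i w) s else weak_deriv_real a b 2 (coord i w) s))"
  have x: "i < n0 \<Longrightarrow> coord i x = coord i w"
    "i < n1 \<Longrightarrow> coord (n0 + i) x = weak_deriv_real a b 1 (coord (n0 + i) w)"
    "i < n2 \<Longrightarrow> coord (n0 + n1 + i) x = weak_deriv_real a b 2 (coord (n0 + n1 + i) w)" for i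
    by (auto simp: x_def coord_def[of _ "\<lambda>s. Matrix.vec _ (_ s)"])
  have "coord i x \<in> L2_real a b" if "i < n0 + n1 + n2" for i
    using that by (cases rule: coord_index_cases)
      (auto simp: x w0 sobolev_real_weak_deriv(1)[OF w1] sobolev_real_weak_deriv(1)[OF w2])
  then have xL: "x \<in> L2 a b (n0 + n1 + n2)" by (auto simp: L2_def x_def)
  have "\<exists>c. ae_eq a b (coord (n0 + i) w) (prim a c (coord (n0 + i) x))" if "i < n1" for i
    unfolding x(2)[OF that] by (rule sobolev_real_1_imp_prim[OF ab w1[OF that]])
  then obtain c where c: "\<And>i. i < n1 \<Longrightarrow> ae_eq a b (coord (n0 + i) w) (prim a (c i) (coord (n0 + i) x))"
    by metis
  have "\<exists>d e. ae_eq a b (coord (n0 + n1 + i) w) (prim a d (prim a e (coord (n0 + n1 + i) x)))" if "i < n2" for i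
    unfolding x(3)[OF that] by (rule sobolev_real_2_imp_prim[OF ab w2[OF that]])
  then obtain d e where de: "\<And>i. i < n2 \<Longrightarrow>
      ae_eq a b (coord (n0 + n1 + i) w) (prim a (d i) (prim a (e i) (coord (n0 + n1 + i) x)))"
    by metis
  define v where "v = Matrix.vec n1 c @\<^sub>v Matrix.vec n2 d @\<^sub>v Matrix.vec n2 e"
  have v: "v \<in> carrier_vec (n1 + 2 * n2)"
    by (rule carrier_vecI) (simp add: v_def)
  have "coord i w \<in> L2_real a b" if "i < n0 + n1 + n2" for i
    using that w0 w1 w2 by (cases rule: coord_index_cases) (auto simp: sobolev_real_def)
  moreover have "\<forall>i<n0. ae_eq a b (coord i w) (coord i x)"
    by (auto simp: x intro: ae_eqI)
  ultimately have "represents x v w"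
    using wc c de by (auto simp: represents_def v_def)
  then show thesis using that xL v by blast
qed

text \<open>Reduces identities between values of the operator to pairs \<open>(x, v)\<close>: two
  functions that arise from the same pair are equal in \<open>L2\<close>.\<close>

lemma represents_unique:
  assumes "represents x v w" "represents x v w'"
  shows "ae_eq a b w w'"
proof (rule ae_eq_coords)
  show "w s \<in> carrier_vec (n0 + n1 + n2)" "w' s \<in> carrier_vec (n0 + n1 + n2)" if "s \<in> {a..b}" for s
    using assms that by (auto simp: represents_def)
  show "ae_eq a b (coord i w) (coord i w')" if "i < n0 + n1 + n2" for i
    using that
  proof (cases rule: coord_index_cases)
    case 1
    then show ?thesis using assms unfolding represents_def by (meson ae_eq_sym ae_eq_trans)
  next
    case (2 j)
    then show ?thesis using assms unfolding represents_def by (meson ae_eq_sym ae_eq_trans)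
  next
    case (3 j)
    then show ?thesis using assms unfolding represents_def by (meson ae_eq_sym ae_eq_trans)
  qed
qed

section \<open>Linearity, and independence of the chosen representatives\<close>

lemma int_consts_add:
  assumes x: "x \<in> L2 a b (n0 + n1 + n2)" and y: "y \<in> L2 a b (n0 + n1 + n2)"
  shows "int_consts (\<lambda>s. x s + y s) = int_consts x + int_consts y"
proof -
  have dim: "dim_vec (Q_mat b n0 n1 n2 0 \<theta> *\<^sub>v u) = 2 * n1 + 4 * n2" for \<theta> u
    unfolding dim_mult_mat_vec by (rule carrier_matD(1)[OF block_mats_carrier(2)])
  have "q_vec (\<lambda>s. x s + y s) = vec_integral (2 * n1 + 4 * n2) {a..b}
      (\<lambda>\<theta>. Q_mat b n0 n1 n2 0 \<theta> *\<^sub>v x \<theta> + Q_mat b n0 n1 n2 0 \<theta> *\<^sub>v y \<theta>)"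
    unfolding q_vec_def using x y
    by (intro vec_integral_cong mult_add_distrib_mat_vec[OF block_mats_carrier(2)]) (auto simp: L2_def)
  also have "\<dots> = q_vec x + q_vec y"
    unfolding q_vec_def
    by (rule vec_integral_add) (rule dim Q_mat_mult_integrable[OF x] Q_mat_mult_integrable[OF y], assumption?)+
  finally show ?thesis
    unfolding int_consts_def by (simp only: mult_add_distrib_mat_vec[OF N_mat_carrier q_vec_carrier q_vec_carrier])
qed

lemma int_consts_smult:
  assumes x: "x \<in> L2 a b (n0 + n1 + n2)"
  shows "int_consts (\<lambda>s. c \<cdot>\<^sub>v x s) = c \<cdot>\<^sub>v int_consts x"
proof -
  have dim: "dim_vec (Q_mat b n0 n1 n2 0 \<theta> *\<^sub>v u) = 2 * n1 + 4 * n2" for \<theta> u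
    unfolding dim_mult_mat_vec by (rule carrier_matD(1)[OF block_mats_carrier(2)])
  have "q_vec (\<lambda>s. c \<cdot>\<^sub>v x s) = vec_integral (2 * n1 + 4 * n2) {a..b}
      (\<lambda>\<theta>. c \<cdot>\<^sub>v (Q_mat b n0 n1 n2 0 \<theta> *\<^sub>v x \<theta>))"
    unfolding q_vec_def using x
    by (intro vec_integral_cong mult_mat_vec[OF block_mats_carrier(2)]) (auto simp: L2_def)
  also have "\<dots> = c \<cdot>\<^sub>v q_vec x"
    unfolding q_vec_def by (rule vec_integral_smult[OF dim])
  finally show ?thesis
    unfolding int_consts_def by (simp only: mult_mat_vec[OF N_mat_carrier q_vec_carrier])
qed

text \<open>Integrals do not distinguish \<open>x\<close> from \<open>y\<close>, so \<open>w\<close>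
  is represented by both with the same constants. In the third block this is applied to the inner
  and then to the outer primitive.\<close>

lemma represents_cong_ae_eq:
  assumes r: "represents x v w" and eq: "ae_eq a b x y"
    and x: "x \<in> L2 a b (n0 + n1 + n2)" and y: "y \<in> L2 a b (n0 + n1 + n2)"
  shows "represents y v w"
proof -
  have prim: "ae_eq a b (prim a c f) (prim a c g)"
    if "ae_eq a b f g" "f \<in> L2_real a b" "g \<in> L2_real a b" for c f g
    using indef_cong_ae_eq[OF that] by (auto intro!: ae_eqI simp: prim_def)
  note L = L2_coord[OF x] L2_coord[OF y] L2_real_prim
  note rx = r[unfolded represents_def]
  have "ae_eq a b (coord i w) (coord i y)" if "i < n0" for i
    by (rule ae_eq_trans[OF _ ae_eq_coord[OF eq]]) (use rx that in blast)
  moreover have "ae_eq a b (coord (n0 + i) w) (prim a (v $ i) (coord (n0 + i) y))" if "i < n1" for i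
  proof (rule ae_eq_trans)
    show "ae_eq a b (prim a (v $ i) (coord (n0 + i) x)) (prim a (v $ i) (coord (n0 + i) y))"
      using that by (intro prim ae_eq_coord[OF eq] L) auto
  qed (use rx that in blast)
  moreover have "ae_eq a b (coord (n0 + n1 + i) w)
      (prim a (v $ (n1 + i)) (prim a (v $ (n1 + n2 + i)) (coord (n0 + n1 + i) y)))" if "i < n2" for i
  proof (rule ae_eq_trans)
    show "ae_eq a b (prim a (v $ (n1 + i)) (prim a (v $ (n1 + n2 + i)) (coord (n0 + n1 + i) x)))
        (prim a (v $ (n1 + i)) (prim a (v $ (n1 + n2 + i)) (coord (n0 + n1 + i) y)))"
      using that by (intro prim ae_eq_coord[OF eq] L) auto
  qed (use rx that in blast)
  ultimately show ?thesis using rx by (simp add: represents_def)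
qed

lemma represents_add:
  assumes r: "represents x v w" "represents y v' w'"
    and x: "x \<in> L2 a b (n0 + n1 + n2)" and y: "y \<in> L2 a b (n0 + n1 + n2)"
    and v: "v' \<in> carrier_vec (n1 + 2 * n2)"
  shows "represents (\<lambda>s. x s + y s) (v + v') (\<lambda>s. w s + w' s)"
proof -
  \<comment> \<open>Agreement of \<open>h\<close> with the sum is asked on \<open>{a..b}\<close>
    only: outside, elements of \<open>L2\<close> may have any dimension, and coordinates of a sum
    need not be sums of coordinates.\<close>
  have prim: "prim a (c + c') h s = prim a c f s + prim a c' g s"
    if "\<And>t. t \<in> {a..b} \<Longrightarrow> h t = f t + g t" "f \<in> L2_real a b" "g \<in> L2_real a b" "s \<in> {a..b}" for c c' f g h s
    using that indef_cong[of a s h "\<lambda>t. f t + g t"] indef_add[OF that(2,3), of s] by (auto simp: prim_def)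
  have coord: "coord i (\<lambda>s. z s + z' s) s = coord i z s + coord i z' s"
    if "z' \<in> L2 a b (n0 + n1 + n2)" "i < n0 + n1 + n2" "s \<in> {a..b}" for z z' i s
    using that(1)[unfolded L2_def carrier_vec_def] that(2,3) by (simp add: coord_def)
  have add: "ae_eq a b h k" if "ae_eq a b f g" "ae_eq a b f' g'"
    "\<And>s. s \<in> {a..b} \<Longrightarrow> h s = f s + f' s" "\<And>s. s \<in> {a..b} \<Longrightarrow> k s = g s + g' s"
    for f f' g g' h k :: "real \<Rightarrow> real"
  proof -
    have "AE s in lebesgue_on {a..b}. s \<in> {a..b}" by (rule AE_I2) simp
    then show ?thesis
      using that(1,2) unfolding ae_eq_def by eventually_elim (simp add: that(3,4))
  qed
  note w = represents_L2[OF r(1)] and w' = represents_L2[OF r(2)]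
  note L = L2_coord[OF x] L2_coord[OF y]
  note rx = r(1)[unfolded represents_def] and ry = r(2)[unfolded represents_def]
  have "ae_eq a b (coord i (\<lambda>s. w s + w' s)) (coord i (\<lambda>s. x s + y s))" if "i < n0" for i
    by (rule add[of "coord i w" "coord i x" "coord i w'" "coord i y"])
      (use rx ry that in \<open>auto simp: coord[OF w'] coord[OF y]\<close>)
  moreover have "ae_eq a b (coord (n0 + i) (\<lambda>s. w s + w' s)) (prim a ((v + v') $ i) (coord (n0 + i) (\<lambda>s. x s + y s)))"
    if "i < n1" for i
  proof (rule add)
    show "ae_eq a b (coord (n0 + i) w) (prim a (v $ i) (coord (n0 + i) x))"
      "ae_eq a b (coord (n0 + i) w') (prim a (v' $ i) (coord (n0 + i) y))"
      using rx ry that by auto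
    have "(v + v') $ i = v $ i + v' $ i" using v that by simp
    then show "prim a ((v + v') $ i) (coord (n0 + i) (\<lambda>s. x s + y s)) s =
        prim a (v $ i) (coord (n0 + i) x) s + prim a (v' $ i) (coord (n0 + i) y) s" if "s \<in> {a..b}" for s
      using \<open>i < n1\<close> that by (simp only:) (rule prim; auto simp: coord[OF y] L)
  qed (use that in \<open>auto simp: coord[OF w']\<close>)
  moreover have "ae_eq a b (coord (n0 + n1 + i) (\<lambda>s. w s + w' s))
      (prim a ((v + v') $ (n1 + i)) (prim a ((v + v') $ (n1 + n2 + i)) (coord (n0 + n1 + i) (\<lambda>s. x s + y s))))"
    if "i < n2" for i
  proof (rule add)
    show "ae_eq a b (coord (n0 + n1 + i) w) (prim a (v $ (n1 + i)) (prim a (v $ (n1 + n2 + i)) (coord (n0 + n1 + i) x)))"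
      "ae_eq a b (coord (n0 + n1 + i) w') (prim a (v' $ (n1 + i)) (prim a (v' $ (n1 + n2 + i)) (coord (n0 + n1 + i) y)))"
      using rx ry that by auto
    have "(v + v') $ (n1 + i) = v $ (n1 + i) + v' $ (n1 + i)"
      "(v + v') $ (n1 + n2 + i) = v $ (n1 + n2 + i) + v' $ (n1 + n2 + i)" using v that by simp_all
    then show "prim a ((v + v') $ (n1 + i)) (prim a ((v + v') $ (n1 + n2 + i)) (coord (n0 + n1 + i) (\<lambda>s. x s + y s))) s =
        prim a (v $ (n1 + i)) (prim a (v $ (n1 + n2 + i)) (coord (n0 + n1 + i) x)) s +
        prim a (v' $ (n1 + i)) (prim a (v' $ (n1 + n2 + i)) (coord (n0 + n1 + i) y)) s" if "s \<in> {a..b}" for s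
      using \<open>i < n2\<close> that
      by (simp only:) (intro prim L2_real_prim L coord[OF y]; simp)
  qed (use that in \<open>auto simp: coord[OF w']\<close>)
  moreover have "(\<lambda>s. w s + w' s) \<in> L2 a b (n0 + n1 + n2)" by (rule L2_add[OF w w'])
  ultimately show ?thesis
    unfolding represents_def by (simp add: L2_def)
qed

lemma represents_smult:
  assumes r: "represents x v w"
    and x: "x \<in> L2 a b (n0 + n1 + n2)" and v: "v \<in> carrier_vec (n1 + 2 * n2)"
  shows "represents (\<lambda>s. c \<cdot>\<^sub>v x s) (c \<cdot>\<^sub>v v) (\<lambda>s. c \<cdot>\<^sub>v w s)"
proof -
  have prim: "prim a (c * k) h s = c * prim a k f s"
    if "\<And>t. t \<in> {a..b} \<Longrightarrow> h t = c * f t" "s \<in> {a..b}" for k f h s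
    using that indef_cong[of a s h "\<lambda>t. c * f t"] by (auto simp: prim_def indef_cmult algebra_simps)
  have coord: "coord i (\<lambda>s. c \<cdot>\<^sub>v z s) s = c * coord i z s"
    if "z \<in> L2 a b (n0 + n1 + n2)" "i < n0 + n1 + n2" "s \<in> {a..b}" for z i s
    using that(1)[unfolded L2_def carrier_vec_def] that(2,3) by (simp add: coord_def)
  have smult: "ae_eq a b h k" if "ae_eq a b f g"
    "\<And>s. s \<in> {a..b} \<Longrightarrow> h s = c * f s" "\<And>s. s \<in> {a..b} \<Longrightarrow> k s = c * g s"
    for f g h k :: "real \<Rightarrow> real"
  proof -
    have "AE s in lebesgue_on {a..b}. s \<in> {a..b}" by (rule AE_I2) simp
    then show ?thesis
      using that(1) unfolding ae_eq_def by eventually_elim (simp add: that(2,3))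
  qed
  note w = represents_L2[OF r]
  note rx = r[unfolded represents_def]
  have "ae_eq a b (coord i (\<lambda>s. c \<cdot>\<^sub>v w s)) (coord i (\<lambda>s. c \<cdot>\<^sub>v x s))" if "i < n0" for i
    by (rule smult[of "coord i w" "coord i x"])
      (use rx that in \<open>auto simp: coord[OF w] coord[OF x]\<close>)
  moreover have "ae_eq a b (coord (n0 + i) (\<lambda>s. c \<cdot>\<^sub>v w s)) (prim a ((c \<cdot>\<^sub>v v) $ i) (coord (n0 + i) (\<lambda>s. c \<cdot>\<^sub>v x s)))"
    if "i < n1" for i
  proof (rule smult)
    show "ae_eq a b (coord (n0 + i) w) (prim a (v $ i) (coord (n0 + i) x))"
      using rx that by auto
    have "(c \<cdot>\<^sub>v v) $ i = c * v $ i" using v that by simp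
    then show "prim a ((c \<cdot>\<^sub>v v) $ i) (coord (n0 + i) (\<lambda>s. c \<cdot>\<^sub>v x s)) s =
        c * prim a (v $ i) (coord (n0 + i) x) s" if "s \<in> {a..b}" for s
      using \<open>i < n1\<close> that by (simp only:) (rule prim; auto simp: coord[OF x])
  qed (use that in \<open>auto simp: coord[OF w]\<close>)
  moreover have "ae_eq a b (coord (n0 + n1 + i) (\<lambda>s. c \<cdot>\<^sub>v w s))
      (prim a ((c \<cdot>\<^sub>v v) $ (n1 + i)) (prim a ((c \<cdot>\<^sub>v v) $ (n1 + n2 + i)) (coord (n0 + n1 + i) (\<lambda>s. c \<cdot>\<^sub>v x s))))"
    if "i < n2" for i
  proof (rule smult)
    show "ae_eq a b (coord (n0 + n1 + i) w) (prim a (v $ (n1 + i)) (prim a (v $ (n1 + n2 + i)) (coord (n0 + n1 + i) x)))"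
      using rx that by auto
    have "(c \<cdot>\<^sub>v v) $ (n1 + i) = c * v $ (n1 + i)"
      "(c \<cdot>\<^sub>v v) $ (n1 + n2 + i) = c * v $ (n1 + n2 + i)" using v that by simp_all
    then show "prim a ((c \<cdot>\<^sub>v v) $ (n1 + i)) (prim a ((c \<cdot>\<^sub>v v) $ (n1 + n2 + i)) (coord (n0 + n1 + i) (\<lambda>s. c \<cdot>\<^sub>v x s))) s =
        c * prim a (v $ (n1 + i)) (prim a (v $ (n1 + n2 + i)) (coord (n0 + n1 + i) x)) s" if "s \<in> {a..b}" for s
      using \<open>i < n2\<close> that
      by (simp only:) (intro prim coord[OF x]; simp)
  qed (use that in \<open>auto simp: coord[OF w]\<close>)
  moreover have "(\<lambda>s. c \<cdot>\<^sub>v w s) \<in> L2 a b (n0 + n1 + n2)" by (rule L2_smult[OF w])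
  ultimately show ?thesis
    unfolding represents_def by (simp add: L2_def)
qed

lemma T_op_in_X_space:
  "x \<in> L2 a b (n0 + n1 + n2) \<Longrightarrow> T_op a b n0 n1 n2 B x \<in> X_space a b n0 n1 n2 B"
  by (simp add: X_space_represents_iff[OF _ int_consts_carrier represents_T_op])

lemma T_op_unitary:
  "unitary_map a b (L2 a b (n0 + n1 + n2)) (L2_inner a b)
    (X_space a b n0 n1 n2 B) (X_inner a b n0 n1 n2) (T_op a b n0 n1 n2 B)"
  unfolding unitary_map_def
proof (intro conjI ballI allI impI)
  let ?V = "L2 a b (n0 + n1 + n2)" and ?U = "T_op a b n0 n1 n2 B"
  fix x assume x: "x \<in> ?V"
  note rx = represents_T_op[OF x]
  show "?U x \<in> X_space a b n0 n1 n2 B" by (rule T_op_in_X_space[OF x])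
  show "ae_eq a b (?U (\<lambda>s. c \<cdot>\<^sub>v x s)) (\<lambda>s. c \<cdot>\<^sub>v ?U x s)" for c
    using represents_unique[OF represents_T_op[OF L2_smult[OF x]]] represents_smult[OF rx x int_consts_carrier]
    by (simp only: int_consts_smult[OF x])
  fix y assume y: "y \<in> ?V"
  note ry = represents_T_op[OF y]
  show "ae_eq a b (?U (\<lambda>s. x s + y s)) (\<lambda>s. ?U x s + ?U y s)"
    using represents_unique[OF represents_T_op[OF L2_add[OF x y]]] represents_add[OF rx ry x y int_consts_carrier]
    by (simp only: int_consts_add[OF x y])
  show "X_inner a b n0 n1 n2 (?U x) (?U y) = L2_inner a b x y"
    by (rule X_inner_represents[OF x y rx ry])
  assume "ae_eq a b x y"
  \<comment> \<open>Now \<open>?U x\<close> arises from \<open>y\<close> with the constants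
    belonging to \<open>x\<close>. Since \<open>?U x\<close> lies in \<open>X\<close>, the boundary
    condition forces these to be the constants belonging to \<open>y\<close>, and then
    \<open>?U x\<close> and \<open>?U y\<close> arise from the same pair.\<close>
  then have r: "represents y (int_consts x) (?U x)" by (rule represents_cong_ae_eq[OF rx _ x y])
  then have "int_consts x = int_consts y"
    using X_space_represents_iff[OF y int_consts_carrier] T_op_in_X_space[OF x] by blast
  then show "ae_eq a b (?U x) (?U y)"
    using r ry by (simp only: represents_unique)
next
  fix w assume w: "w \<in> X_space a b n0 n1 n2 B"
  then obtain x v where x: "x \<in> L2 a b (n0 + n1 + n2)" and v: "v \<in> carrier_vec (n1 + 2 * n2)"
    and r: "represents x v w"
    by (rule X_space_imp_represents)
  \<comment> \<open>Membership of \<open>w\<close> in \<open>X\<close> leaves no freedom for its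
    constants: they are those that the operator assigns to \<open>x\<close>, so \<open>w\<close> is
    the image of \<open>x\<close>.\<close>
  have "v = int_consts x" using X_space_represents_iff[OF x v r] w by blast
  then have "ae_eq a b (T_op a b n0 n1 n2 B x) w"
    using represents_unique[OF represents_T_op[OF x]] r by blast
  then show "\<exists>x\<in>L2 a b (n0 + n1 + n2). ae_eq a b (T_op a b n0 n1 n2 B x) w"
    using x by blast
qed

end

theorem corollary12:
  fixes a b :: real and n0 n1 n2 :: nat and B :: "real mat"
  assumes "a < b"
    and "B \<in> carrier_mat (n1 + 2 * n2) (2 * n1 + 4 * n2)"
    and "invertible_mat (B * T_mat a b n1 n2)"
  shows "unitary_map a b
           (L2 a b (n0 + n1 + n2)) (L2_inner a b)
           (X_space a b n0 n1 n2 B) (X_inner a b n0 n1 n2)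
           (T_op a b n0 n1 n2 B)"
proof -
  interpret three_PI a b n0 n1 n2 B
    using assms by unfold_locales
  show ?thesis by (rule T_op_unitary)
qed

end
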